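(* Let $n\geq 6$ and let $\mathcal L$ be an $n$-dimensional naturally graded $2$-filiform non-split complex Leibniz algebra of type $\mu_{(I,1,2)}$. Then $\mathcal L$ is isomorphic to one of the following two algebras, which are not isomorphic to each other (each given on a basis $\{e_1,\dots,e_n\}$, all products of basis elements not listed being zero): $$\text{(1)}\quad \begin{cases}[e_i,e_1]=e_{i+1}, & 1\leq i\leq n-3,\\ [e_1,e_{n-1}]=e_2+e_n, & \\ [e_i,e_{n-1}]=e_{i+1}, & 2\leq i\leq n-3;\end{cases}$$ $$\text{(2)}\quad \begin{cases}[e_i,e_1]=e_{i+1}, & 1\leq i\leq n-3,\\ [e_1,e_{n-1}]=e_n. &\end{cases}$$
   Context: All algebras are finite-dimensional over $\mathbb C$. A Leibniz algebra is a vector space with a bilinear bracket satisfying $[x,[y,z]]=[[x,y],z]-[[x,z],y]$. Put $\mathcal L^1=\mathcal L$, $\mathcal L^{k+1}=[\mathcal L^k,\mathcal L]$; $\mathcal L$ is nilpotent if $\mathcal L^k=0$ for some $k$. It is non-split if it is not a direct sum of two nonzero ideals. For $x\in\mathcal L$ let $R_x(z)=[z,x]$. For nilpotent $\mathcal L$ and $x\in\mathcal L\setminus[\mathcal L,\mathcal L]$ let $C(x)$ be the decreasing sequence of sizes of the Jordan blocks of the nilpotent operator $R_x$; the characteristic sequence is $C(\mathcal L)=\max_{x\in\mathcal L\setminus[\mathcal L,\mathcal L]}C(x)$ in the lexicographic order. An $n$-dimensional nilpotent Leibniz algebra is $2$-filiform if $C(\mathcal L)=(n-2,1,1)$. Natural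 gradation: $\mathcal L_i=\mathcal L^i/\mathcal L^{i+1}$, $i\geq1$, with the induced bracket $[\mathcal L_i,\mathcal L_j]\subseteq\mathcal L_{i+j}$. $\mathcal L$ is naturally graded if $\mathcal L\cong\bigoplus_i\mathcal L_i$ as algebras; one then identifies $\mathcal L$ with $\bigoplus_i\mathcal L_i$. A naturally graded $2$-filiform algebra is of type $\mu_{(I,r_1,r_2)}$ (with $r_1\le r_2$) if it has a basis $\{e_1,\dots,e_n\}$ (adapted basis) of homogeneous elements with $e_1\in\mathcal L_1$, $C(e_1)=(n-2,1,1)$, $[e_i,e_1]=e_{i+1}$ for $1\le i\le n-3$, $[e_{n-2},e_1]=[e_{n-1},e_1]=[e_n,e_1]=0$ (so $e_i\in\mathcal L_i$ for $1\le i\le n-2$), and $e_{n-1}\in\mathcal L_{r_1}$, $e_n\in\mathcal L_{r_2}$. *)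

theory Defs
  imports "HOL-Algebra.AbelCoset" "Jordan_Normal_Form.Jordan_Normal_Form" "Jordan_Normal_Form.VS_Connect"
begin

text \<open>An algebra over the complex numbers is a record of type \<open>(complex, 'a) module\<close> over the field
  \<open>class_ring\<close>; its bracket \<open>[x, y]\<close> is the field \<open>mult\<close>, written \<open>x \<otimes>\<^bsub>L\<^esub> y\<close>. The field \<open>one\<close>
  of the record is never used.\<close>

locale leibniz_algebra = vectorspace "class_ring :: complex ring" L
  for L :: "(complex, 'a) module" (structure) +
  assumes finite_dimensional: "fin_dim"
    and bracket_closed: "\<lbrakk>x \<in> carrier L; y \<in> carrier L\<rbrakk> \<Longrightarrow> x \<otimes> y \<in> carrier L"
    and bracket_add_left: "\<lbrakk>x \<in> carrier L; y \<in> carrier L; z \<in> carrier L\<rbrakk>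
          \<Longrightarrow> (x \<oplus> y) \<otimes> z = x \<otimes> z \<oplus> y \<otimes> z"
    and bracket_add_right: "\<lbrakk>x \<in> carrier L; y \<in> carrier L; z \<in> carrier L\<rbrakk>
          \<Longrightarrow> x \<otimes> (y \<oplus> z) = x \<otimes> y \<oplus> x \<otimes> z"
    and bracket_smult_left: "\<lbrakk>x \<in> carrier L; y \<in> carrier L\<rbrakk> \<Longrightarrow> (c \<odot> x) \<otimes> y = c \<odot> (x \<otimes> y)"
    and bracket_smult_right: "\<lbrakk>x \<in> carrier L; y \<in> carrier L\<rbrakk> \<Longrightarrow> x \<otimes> (c \<odot> y) = c \<odot> (x \<otimes> y)"
    and leibniz_identity: "\<lbrakk>x \<in> carrier L; y \<in> carrier L; z \<in> carrier L\<rbrakk>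
          \<Longrightarrow> x \<otimes> (y \<otimes> z) = (x \<otimes> y) \<otimes> z \<ominus> (x \<otimes> z) \<otimes> y"

abbreviation alg_dim :: "(complex, 'a) module \<Rightarrow> nat" where
  "alg_dim L \<equiv> vectorspace.dim class_ring L"

definition alg_iso :: "(complex, 'a) module \<Rightarrow> (complex, 'b) module \<Rightarrow> ('a \<Rightarrow> 'b) set" where
  "alg_iso L M = {\<phi>. \<phi> \<in> module_hom class_ring L M \<and> bij_betw \<phi> (carrier L) (carrier M) \<and>
     (\<forall>x\<in>carrier L. \<forall>y\<in>carrier L. \<phi> (x \<otimes>\<^bsub>L\<^esub> y) = \<phi> x \<otimes>\<^bsub>M\<^esub> \<phi> y)}"

definition alg_isomorphic :: "(complex, 'a) module \<Rightarrow> (complex, 'b) module \<Rightarrow> bool" where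
  "alg_isomorphic L M \<longleftrightarrow> alg_iso L M \<noteq> {}"

definition indexed_basis :: "(complex, 'a) module \<Rightarrow> (nat \<Rightarrow> 'a) \<Rightarrow> nat set \<Rightarrow> bool" where
  "indexed_basis L e I \<longleftrightarrow> inj_on e I \<and> vectorspace.basis class_ring L (e ` I)"


definition bracket_span :: "(complex, 'a) module \<Rightarrow> 'a set \<Rightarrow> 'a set \<Rightarrow> 'a set" where
  "bracket_span L U V = LinearCombinations.module.span class_ring L {u \<otimes>\<^bsub>L\<^esub> v | u v. u \<in> U \<and> v \<in> V}"

text \<open>\<open>lcs L k\<close> is \<open>L\<^sup>k\<close> for \<open>k \<ge> 1\<close>, where \<open>L\<^sup>1 = L\<close>; the value at \<open>0\<close> is only a convention.\<close>

primrec lcs :: "(complex, 'a) module \<Rightarrow> nat \<Rightarrow> 'a set" where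
  "lcs L 0 = carrier L"
| "lcs L (Suc k) = (if k = 0 then carrier L else bracket_span L (lcs L k) (carrier L))"

definition nilpotent_alg :: "(complex, 'a) module \<Rightarrow> bool" where
  "nilpotent_alg L \<longleftrightarrow> (\<exists>k\<ge>1. lcs L k = {\<zero>\<^bsub>L\<^esub>})"

definition alg_ideal :: "(complex, 'a) module \<Rightarrow> 'a set \<Rightarrow> bool" where
  "alg_ideal L I \<longleftrightarrow> submodule class_ring I L \<and>
     (\<forall>x\<in>I. \<forall>y\<in>carrier L. x \<otimes>\<^bsub>L\<^esub> y \<in> I \<and> y \<otimes>\<^bsub>L\<^esub> x \<in> I)"

definition non_split :: "(complex, 'a) module \<Rightarrow> bool" where
  "non_split L \<longleftrightarrow> \<not> (\<exists>I J. alg_ideal L I \<and> alg_ideal L J \<and> I \<noteq> {\<zero>\<^bsub>L\<^esub>} \<and> J \<noteq> {\<zero>\<^bsub>L\<^esub>} \<and>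
     I \<inter> J = {\<zero>\<^bsub>L\<^esub>} \<and> I <+>\<^bsub>L\<^esub> J = carrier L)"


definition right_mult :: "(complex, 'a) module \<Rightarrow> 'a \<Rightarrow> 'a \<Rightarrow> 'a" where
  "right_mult L x = (\<lambda>z. z \<otimes>\<^bsub>L\<^esub> x)"

text \<open>\<open>jordan_sizes L T s\<close>: \<open>s\<close> is the decreasing sequence of sizes of the Jordan blocks of the nilpotent
  operator \<open>T\<close>, i.e. in some ordered basis \<open>b 0, b 1, \<dots>\<close> of \<open>L\<close> the matrix of \<open>T\<close> is the
  block diagonal matrix of Jordan blocks of sizes \<open>s\<close> with eigenvalue \<open>0\<close>. (This is a relation; for a
  nilpotent operator exactly one \<open>s\<close> satisfies it.)\<close>

definition jordan_sizes :: "(complex, 'a) module \<Rightarrow> ('a \<Rightarrow> 'a) \<Rightarrow> nat list \<Rightarrow> bool" where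
  "jordan_sizes L T s \<longleftrightarrow> sorted_wrt (\<ge>) s \<and> 0 \<notin> set s \<and>
     (\<exists>b. indexed_basis L b {..<sum_list s} \<and>
       (\<forall>j<sum_list s. T (b j) =
         (\<Oplus>\<^bsub>L\<^esub>i\<in>{..<sum_list s}. (jordan_matrix (map (\<lambda>k. (k, 0)) s) $$ (i, j)) \<odot>\<^bsub>L\<^esub> b i)))"

definition char_sequence :: "(complex, 'a) module \<Rightarrow> nat list \<Rightarrow> bool" where
  "char_sequence L s \<longleftrightarrow>
     (\<exists>x\<in>carrier L - bracket_span L (carrier L) (carrier L). jordan_sizes L (right_mult L x) s) \<and>
     (\<forall>x\<in>carrier L - bracket_span L (carrier L) (carrier L). \<forall>t.
        jordan_sizes L (right_mult L x) t \<longrightarrow> t = s \<or> (t, s) \<in> lexord less_than)"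

definition two_filiform :: "(complex, 'a) module \<Rightarrow> bool" where
  "two_filiform L \<longleftrightarrow> nilpotent_alg L \<and> char_sequence L [alg_dim L - 2, 1, 1]"


text \<open>The natural gradation. An element of the direct sum of the \<open>L\<^sub>i = L\<^sup>i / L\<^sup>i\<^sup>+\<^sup>1\<close>, \<open>i \<ge> 1\<close>, is the family
  of its components, each one a coset of \<open>L\<^sup>i\<^sup>+\<^sup>1\<close> in \<open>L\<^sup>i\<close>.\<close>

definition gr_carrier :: "(complex, 'a) module \<Rightarrow> (nat \<Rightarrow> 'a set) set" where
  "gr_carrier L = {f \<in> (\<Pi>\<^sub>E i\<in>{1..}. (\<lambda>x. lcs L (Suc i) +>\<^bsub>L\<^esub> x) ` lcs L i).
     finite {i\<in>{1..}. f i \<noteq> lcs L (Suc i)}}"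

text \<open>In degree \<open>k\<close> the product of \<open>f\<close> and \<open>g\<close> is the class modulo \<open>L\<^sup>k\<^sup>+\<^sup>1\<close> of the sum over \<open>i + j = k\<close> of
  \<open>[x\<^sub>i, y\<^sub>j]\<close>, for representatives \<open>x\<^sub>i\<close> of \<open>f i\<close> and \<open>y\<^sub>j\<close> of \<open>g j\<close>.\<close>

definition gr_bracket ::
  "(complex, 'a) module \<Rightarrow> (nat \<Rightarrow> 'a set) \<Rightarrow> (nat \<Rightarrow> 'a set) \<Rightarrow> nat \<Rightarrow> 'a set" where
  "gr_bracket L f g = (\<lambda>k\<in>{1..}. lcs L (Suc k) <+>\<^bsub>L\<^esub>
     {\<Oplus>\<^bsub>L\<^esub>i\<in>{1..<k}. x i \<otimes>\<^bsub>L\<^esub> y (k - i) | x y. \<forall>i\<in>{1..<k}. x i \<in> f i \<and> y i \<in> g i})"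

text \<open>The summand \<open>L\<^sup>i\<^sup>+\<^sup>1\<close> in the scalar multiplication only matters for the scalar \<open>0\<close>.\<close>

definition gr :: "(complex, 'a) module \<Rightarrow> (complex, nat \<Rightarrow> 'a set) module" where
  "gr L = \<lparr>carrier = gr_carrier L,
     monoid.mult = gr_bracket L,
     one = undefined,
     zero = (\<lambda>i\<in>{1..}. lcs L (Suc i)),
     add = (\<lambda>f g. \<lambda>i\<in>{1..}. f i <+>\<^bsub>L\<^esub> g i),
     module.smult = (\<lambda>c f. \<lambda>i\<in>{1..}. lcs L (Suc i) <+>\<^bsub>L\<^esub> ((\<lambda>x. c \<odot>\<^bsub>L\<^esub> x) ` f i))\<rparr>"

definition gr_component :: "(complex, 'a) module \<Rightarrow> nat \<Rightarrow> (nat \<Rightarrow> 'a set) set" where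
  "gr_component L i = {f \<in> carrier (gr L). \<forall>j\<ge>1. j \<noteq> i \<longrightarrow> f j = lcs L (Suc j)}"

definition naturally_graded :: "(complex, 'a) module \<Rightarrow> bool" where
  "naturally_graded L \<longleftrightarrow> alg_isomorphic L (gr L)"

text \<open>Adapted bases of type \<open>\<mu>\<^bsub>(I,r\<^sub>1,r\<^sub>2)\<^esub>\<close>, where \<open>\<phi>\<close> is the isomorphism by which \<open>L\<close> is
  identified with \<open>gr L\<close>.\<close>

definition adapted_basis ::
  "(complex, 'a) module \<Rightarrow> ('a \<Rightarrow> nat \<Rightarrow> 'a set) \<Rightarrow> nat \<Rightarrow> nat \<Rightarrow> (nat \<Rightarrow> 'a) \<Rightarrow> bool" where
  "adapted_basis L \<phi> r1 r2 e \<longleftrightarrow> (let n = alg_dim L in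
     indexed_basis L e {1..n} \<and>
     jordan_sizes L (right_mult L (e 1)) [n - 2, 1, 1] \<and>
     (\<forall>i\<in>{1..n - 3}. e i \<otimes>\<^bsub>L\<^esub> e 1 = e (i + 1)) \<and>
     (\<forall>i\<in>{n - 2, n - 1, n}. e i \<otimes>\<^bsub>L\<^esub> e 1 = \<zero>\<^bsub>L\<^esub>) \<and>
     (\<forall>i\<in>{1..n - 2}. \<phi> (e i) \<in> gr_component L i) \<and>
     \<phi> (e (n - 1)) \<in> gr_component L r1 \<and>
     \<phi> (e n) \<in> gr_component L r2)"

definition type_mu_I :: "(complex, 'a) module \<Rightarrow> nat \<Rightarrow> nat \<Rightarrow> bool" where
  "type_mu_I L r1 r2 \<longleftrightarrow> naturally_graded L \<and> two_filiform L \<and> r1 \<le> r2 \<and>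
     (\<exists>\<phi>\<in>alg_iso L (gr L). \<exists>e. adapted_basis L \<phi> r1 r2 e)"


text \<open>The algebra on \<open>n\<close>-dimensional coordinate space, with standard basis \<open>e\<^sub>1, \<dots>, e\<^sub>n\<close>, in which
  \<open>[e\<^sub>i, e\<^sub>j] = T i j\<close>. The indices of \<open>T\<close> start at \<open>1\<close>, those of vectors at \<open>0\<close>.\<close>

definition table_algebra ::
  "nat \<Rightarrow> (nat \<Rightarrow> nat \<Rightarrow> complex vec) \<Rightarrow> (complex, complex vec) module" where
  "table_algebra n T = (module_vec TYPE(complex) n)
     \<lparr>monoid.mult := (\<lambda>u v. vec n (\<lambda>k. \<Sum>i<n. \<Sum>j<n. u $ i * v $ j * T (Suc i) (Suc j) $ k))\<rparr>"

definition std_basis :: "nat \<Rightarrow> nat \<Rightarrow> complex vec" where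
  "std_basis n i = unit_vec n (i - 1)"

definition algebra1 :: "nat \<Rightarrow> (complex, complex vec) module" where
  "algebra1 n = table_algebra n (\<lambda>i j.
     if j = 1 \<and> 1 \<le> i \<and> i \<le> n - 3 then std_basis n (i + 1)
     else if j = n - 1 \<and> i = 1 then std_basis n 2 + std_basis n n
     else if j = n - 1 \<and> 2 \<le> i \<and> i \<le> n - 3 then std_basis n (i + 1)
     else 0\<^sub>v n)"

definition algebra2 :: "nat \<Rightarrow> (complex, complex vec) module" where
  "algebra2 n = table_algebra n (\<lambda>i j.
     if j = 1 \<and> 1 \<le> i \<and> i \<le> n - 3 then std_basis n (i + 1)
     else if j = n - 1 \<and> i = 1 then std_basis n n
     else 0\<^sub>v n)"

end

theory Submission
  imports Defs
begin

text \<open>Transporting the gradation of \<open>gr L\<close> to \<open>L\<close>, the homogeneous parts of degrees \<open>1\<close> and \<open>2\<close> are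
  spanned by \<open>e\<^sub>1, f\<close> and \<open>e\<^sub>2, g\<close>, where \<open>f = e\<^sub>n\<^sub>-\<^sub>1\<close> and \<open>g = e\<^sub>n\<close>. Hence \<open>[e\<^sub>1, f] = a e\<^sub>2 + b g\<close> and
  \<open>[f, f] = c e\<^sub>2 + d g\<close>; since degree \<open>2\<close> is generated by degree \<open>1\<close>, \<open>(b, d) \<noteq> 0\<close>. The elements
  \<open>[x, x]\<close> and \<open>[x, y] + [y, x]\<close> annihilate \<open>L\<close> from the right, so all of \<open>e\<^sub>2, \<dots>, e\<^sub>n\<^sub>-\<^sub>2, g\<close> do.
  Then right multiplications by \<open>e\<^sub>1\<close> and \<open>f\<close> commute, which forces \<open>c = 0\<close>, \<open>[g, f] = 0\<close> and
  \<open>[e\<^sub>i, f] = a e\<^sub>i\<^sub>+\<^sub>1\<close>. If \<open>d \<noteq> 0\<close>, some \<open>e\<^sub>1 + \<beta> f\<close> has Jordan blocks of sizes \<open>n - 2, 2\<close>,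
  contradicting 2-filiformity. So \<open>d = 0 \<noteq> b\<close>, and rescaling \<open>f\<close> and \<open>g\<close> gives the first algebra if
  \<open>a \<noteq> 0\<close> and the second one if \<open>a = 0\<close>. The two are distinguished by whether \<open>[x, x] = 0\<close> for every
  \<open>x\<close> whose right multiplication kills all brackets: in the first algebra \<open>x = e\<^sub>1 - e\<^sub>n\<^sub>-\<^sub>1\<close> violates this.\<close>

section \<open>Cosets, complex scalars and the lower central series\<close>

lemma a_r_coset_zero_mem:
  assumes "additive_subgroup H G" "abelian_group G" "x \<in> carrier G" "\<zero>\<^bsub>G\<^esub> \<in> H +>\<^bsub>G\<^esub> x"
  shows "H +>\<^bsub>G\<^esub> x = H"
proof -
  interpret abelian_subgroup H G
    by (rule abelian_subgroupI3[OF assms(1,2)])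
  have "H +>\<^bsub>G\<^esub> \<zero>\<^bsub>G\<^esub> = H +>\<^bsub>G\<^esub> x"
    using a_repr_independence'[OF assms(4,3)] by simp
  then show ?thesis
    using a_coset_add_zero[OF a_subset] by simp
qed

context leibniz_algebra
begin

text \<open>The module axioms are rewritten with \<open>+\<close> and \<open>*\<close> of the
  complex numbers in place of the operations of \<open>class_ring\<close>, so that scalars compute
  directly.\<close>

lemma smult_add_left: "x \<in> carrier L \<Longrightarrow> (a + b) \<odot> x = a \<odot> x \<oplus> b \<odot> x"
  using smult_l_distr[of a b x] by simp

lemma smult_mult: "x \<in> carrier L \<Longrightarrow> (a * b) \<odot> x = a \<odot> (b \<odot> x)"
  using smult_assoc1[of a b x] by simp

lemma smult_add_right: "x \<in> carrier L \<Longrightarrow> y \<in> carrier L \<Longrightarrow> a \<odot> (x \<oplus> y) = a \<odot> x \<oplus> a \<odot> y"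
  using smult_r_distr[of a x y] by simp

lemma smult_carrier [simp]: "x \<in> carrier L \<Longrightarrow> a \<odot> x \<in> carrier L"
  using smult_closed[of a x] by simp

lemma smult_1 [simp]: "x \<in> carrier L \<Longrightarrow> 1 \<odot> x = x"
  using smult_one[of x] by simp

lemma smult_0 [simp]: "x \<in> carrier L \<Longrightarrow> 0 \<odot> x = \<zero>"
  using lmult_0[of x] by simp

lemma smult_zero [simp]: "a \<odot> \<zero> = \<zero>"
  using rmult_0[of a] by simp

lemma smult_uminus: "x \<in> carrier L \<Longrightarrow> (-1) \<odot> x = \<ominus> x"
  using smult_minus_1[of x] by (simp add: class_ring_simps)

lemma smult_eq_zero_iff: "x \<in> carrier L \<Longrightarrow> a \<odot> x = \<zero> \<longleftrightarrow> a = 0 \<or> x = \<zero>"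
  by (metis left_inverse smult_0 smult_1 smult_mult smult_zero)

declare bracket_closed [simp]

lemma zero_bracket [simp]: "x \<in> carrier L \<Longrightarrow> \<zero> \<otimes> x = \<zero>"
  using bracket_smult_left[of \<zero> x 0] by simp

lemma bracket_zero [simp]: "x \<in> carrier L \<Longrightarrow> x \<otimes> \<zero> = \<zero>"
  using bracket_smult_right[of x \<zero> 0] by simp

lemma lcs_submodule: "submodule class_ring (lcs L k) L"
proof (induction k)
  case 0
  show ?case by unfold_locales auto
next
  case (Suc k)
  have "{u \<otimes> v | u v. u \<in> lcs L k \<and> v \<in> carrier L} \<subseteq> carrier L"
    using submodule.subset[OF Suc] bracket_closed by auto
  moreover have "submodule class_ring (carrier L) L"
    by unfold_locales auto
  ultimately show ?case
    using span_is_submodule by (auto simp: bracket_span_def)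
qed

lemma lcs_subset_carrier: "lcs L k \<subseteq> carrier L"
  using submodule.subset[OF lcs_submodule] .

lemma zero_mem_lcs: "\<zero> \<in> lcs L k"
  using submodule.zero_closed[OF lcs_submodule] .

text \<open>Closure under negation comes from multiplication by -1. This gives access to the theory
  of cosets, which is stated for additive subgroups.\<close>

lemma submodule_additive_subgroup:
  assumes "submodule class_ring N L"
  shows "additive_subgroup N L"
proof -
  interpret N: submodule class_ring N L by fact
  have "\<ominus> x \<in> N" if "x \<in> N" for x
  proof -
    have "x \<in> carrier L" using that N.subset by auto
    then have "\<ominus> x = (\<ominus>\<^bsub>class_ring\<^esub> \<one>\<^bsub>class_ring\<^esub>) \<odot> x"
      using smult_minus_1 by simp
    then show ?thesis
      using N.smult_closed[OF _ that, of "\<ominus>\<^bsub>class_ring\<^esub> \<one>\<^bsub>class_ring\<^esub>"] by simp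
  qed
  then show ?thesis
    unfolding additive_subgroup_def
    by (intro subgroup.intro) (use N.subset in \<open>auto simp: a_inv_def\<close>)
qed

end

section \<open>Finite sums and coordinates with respect to an indexed basis\<close>

context vectorspace
begin

lemma lincomb_image:
  assumes "inj_on e I" "e \<in> I \<rightarrow> carrier V" "a \<in> e ` I \<rightarrow> carrier K"
  shows "lincomb a (e ` I) = (\<Oplus>\<^bsub>V\<^esub>i\<in>I. a (e i) \<odot>\<^bsub>V\<^esub> e i)"
  unfolding lincomb_def using assms by (subst finsum_reindex) auto

end

context leibniz_algebra
begin

lemma smult_sum_left:
  assumes "x \<in> carrier L" "finite A"
  shows "(\<Sum>i\<in>A. f i) \<odot> x = (\<Oplus>i\<in>A. f i \<odot> x)"
  using assms(2) by induction (simp_all add: assms(1) smult_add_left Pi_def)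

lemma finsum_smult_right:
  assumes "finite A" "g \<in> A \<rightarrow> carrier L"
  shows "a \<odot> (\<Oplus>i\<in>A. g i) = (\<Oplus>i\<in>A. a \<odot> g i)"
  using assms by (induction A) (auto simp: smult_add_right Pi_def)

lemma finsum_bracket_left:
  assumes "finite A" "g \<in> A \<rightarrow> carrier L" "y \<in> carrier L"
  shows "(\<Oplus>i\<in>A. g i) \<otimes> y = (\<Oplus>i\<in>A. g i \<otimes> y)"
  using assms by (induction A) (auto simp: bracket_add_left Pi_def)

lemma finsum_bracket_right:
  assumes "finite A" "g \<in> A \<rightarrow> carrier L" "y \<in> carrier L"
  shows "y \<otimes> (\<Oplus>i\<in>A. g i) = (\<Oplus>i\<in>A. y \<otimes> g i)"
  using assms by (induction A) (auto simp: bracket_add_right Pi_def)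

lemma finsum_finsum_commute:
  assumes "finite A" "finite B" "\<And>i j. i \<in> A \<Longrightarrow> j \<in> B \<Longrightarrow> g i j \<in> carrier L"
  shows "(\<Oplus>i\<in>A. \<Oplus>j\<in>B. g i j) = (\<Oplus>j\<in>B. \<Oplus>i\<in>A. g i j)"
  using assms(1,3)
proof (induction A)
  case (insert a A)
  then have "(\<Oplus>i\<in>insert a A. \<Oplus>j\<in>B. g i j) = (\<Oplus>j\<in>B. g a j) \<oplus> (\<Oplus>j\<in>B. \<Oplus>i\<in>A. g i j)"
    by (auto simp: Pi_def)
  also have "\<dots> = (\<Oplus>j\<in>B. g a j \<oplus> (\<Oplus>i\<in>A. g i j))"
    using insert by (intro finsum_addf[symmetric]) auto
  also have "\<dots> = (\<Oplus>j\<in>B. \<Oplus>i\<in>insert a A. g i j)"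
    using insert by (intro finsum_cong') (auto simp: Pi_def)
  finally show ?case .
qed simp

lemma indexed_basis_carrier:
  assumes "indexed_basis L e I" "i \<in> I"
  shows "e i \<in> carrier L"
  using assms by (auto simp: indexed_basis_def basis_def)

lemma indexed_basis_repr:
  assumes "indexed_basis L e I" "finite I" "x \<in> carrier L"
  obtains c where "x = (\<Oplus>i\<in>I. c i \<odot> e i)"
proof -
  have *: "inj_on e I" "e ` I \<subseteq> carrier L" "x \<in> span (e ` I)"
    using assms by (auto simp: indexed_basis_def basis_def)
  then obtain a where a: "lincomb a (e ` I) = x"
    using finite_in_span[of "e ` I" x] assms(2) by auto
  then have "x = (\<Oplus>i\<in>I. a (e i) \<odot> e i)"
    using lincomb_image[of e I a] * by auto
  then show ?thesis
    by (rule that)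
qed

text \<open>Linear independence speaks of coefficients attached to vectors. Injectivity of
  \<open>e\<close> carries the coefficients from indices to vectors, where a nonzero one would give
  a dependency.\<close>

lemma indexed_basis_indep:
  assumes "indexed_basis L e I" "finite I" "(\<Oplus>i\<in>I. c i \<odot> e i) = \<zero>" "i \<in> I"
  shows "c i = 0"
proof (rule ccontr)
  assume "c i \<noteq> 0"
  have *: "inj_on e I" "e ` I \<subseteq> carrier L" "lin_indpt (e ` I)"
    using assms by (auto simp: indexed_basis_def basis_def)
  define a where "a = c \<circ> inv_into I e"
  have a: "a (e j) = c j" if "j \<in> I" for j
    using that * by (simp add: a_def)
  have "lincomb a (e ` I) = (\<Oplus>i\<in>I. a (e i) \<odot> e i)"
    using lincomb_image[of e I a] * by auto
  also have "\<dots> = \<zero>"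
    using a * by (subst assms(3)[symmetric], intro finsum_cong') auto
  finally have "lin_dep (e ` I)"
    using \<open>c i \<noteq> 0\<close> a assms(2,4) by (intro lin_dep_crit[of "e ` I" _ a "e i"]) auto
  then show False
    using * by simp
qed

lemma indexed_basis_dim:
  assumes "indexed_basis L e I" "finite I"
  shows "dim = card I"
  using dim_basis[of "e ` I"] assms by (auto simp: indexed_basis_def card_image)

text \<open>A generating set with at most \<open>dim\<close> elements is a basis. Its cardinality is
  then exactly \<open>dim\<close>, which equals \<open>card I\<close>, and this forces
  \<open>b\<close> to be injective on \<open>I\<close>.\<close>

lemma indexed_basisI:
  assumes "indexed_basis L e J" "finite J" "finite I" "card I = card J"
    and "\<And>i. i \<in> I \<Longrightarrow> b i \<in> carrier L" "\<And>j. j \<in> J \<Longrightarrow> e j \<in> span (b ` I)"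
  shows "indexed_basis L b I"
proof -
  have b: "b ` I \<subseteq> carrier L"
    using assms by auto
  have "span (e ` J) = carrier L"
    using assms(1) by (auto simp: indexed_basis_def basis_def)
  moreover have "span (e ` J) \<subseteq> span (b ` I)"
    using assms(6) b by (intro span_is_subset span_is_submodule) auto
  ultimately have gen: "span (b ` I) = carrier L"
    using span_is_subset2[OF b] by auto
  have dim: "dim = card I"
    using indexed_basis_dim[OF assms(1,2)] assms(4) by simp
  then have "card (b ` I) \<le> dim"
    using card_image_le[OF assms(3)] by simp
  then have basis: "basis (b ` I)"
    using gen b assms(3) by (intro dim_gen_is_basis) auto
  then have "card (b ` I) = card I"
    using dim_basis[of "b ` I"] dim assms(3) by simp
  then show ?thesis
    using basis assms(3) by (auto simp: indexed_basis_def intro: eq_card_imp_inj_on)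
qed

lemma span_smult_mem:
  assumes "S \<subseteq> carrier L" "x \<in> carrier L" "a \<noteq> 0" "a \<odot> x \<in> span S"
  shows "x \<in> span S"
proof -
  have "inverse a \<odot> (a \<odot> x) \<in> span S"
    using submodule.smult_closed[OF span_is_submodule[OF assms(1)] _ assms(4)] by simp
  then show ?thesis
    using assms(2,3) by (simp add: smult_mult[symmetric])
qed

section \<open>The right annihilator and commuting right multiplications\<close>

definition right_annihilator :: "'a set" where
  "right_annihilator = {z \<in> carrier L. \<forall>x\<in>carrier L. x \<otimes> z = \<zero>}"

lemma right_annihilator_submodule: "submodule class_ring right_annihilator L"
  by unfold_locales (auto simp: right_annihilator_def bracket_add_right bracket_smult_right)

text \<open>In \<open>[u, [x, x]]\<close> the two terms of the Leibniz identity coincide and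
  cancel.\<close>

lemma square_right_annihilator: "x \<in> carrier L \<Longrightarrow> x \<otimes> x \<in> right_annihilator"
  by (auto simp: right_annihilator_def leibniz_identity)

text \<open>Both terms in the expansion of \<open>[u, [z, x]]\<close> contain a right multiplication
  by \<open>z\<close>.\<close>

lemma bracket_right_annihilator:
  "z \<in> right_annihilator \<Longrightarrow> x \<in> carrier L \<Longrightarrow> z \<otimes> x \<in> right_annihilator"
  by (auto simp: right_annihilator_def leibniz_identity)

lemma minus_eq_zeroD: "x \<ominus> y = \<zero> \<Longrightarrow> x \<in> carrier L \<Longrightarrow> y \<in> carrier L \<Longrightarrow> x = y"
  using minus_equality[of x "\<ominus> y"] by (simp add: a_minus_def)

text \<open>By the Leibniz identity the commutator of the right multiplications by \<open>x\<close>
  and \<open>y\<close> is, up to sign, the right multiplication by \<open>[x, y]\<close>, which is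
  zero here.\<close>

lemma right_mult_commute:
  assumes "x \<otimes> y \<in> right_annihilator" "u \<in> carrier L" "x \<in> carrier L" "y \<in> carrier L"
  shows "(u \<otimes> x) \<otimes> y = (u \<otimes> y) \<otimes> x"
  using assms leibniz_identity[of u x y] minus_eq_zeroD[of "(u \<otimes> x) \<otimes> y" "(u \<otimes> y) \<otimes> x"]
  by (auto simp: right_annihilator_def)

text \<open>Exchanging \<open>x\<close> and \<open>y\<close> in the Leibniz identity only changes
  the sign, so \<open>[u, [x, y]] = - [u, [y, x]]\<close>, and the right-hand side vanishes.\<close>

lemma bracket_mem_right_annihilator:
  assumes "y \<otimes> x = \<zero>" "x \<in> carrier L" "y \<in> carrier L"
  shows "x \<otimes> y \<in> right_annihilator"
proof -
  have "u \<otimes> (x \<otimes> y) = \<zero>" if u: "u \<in> carrier L" for u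
  proof -
    have "(u \<otimes> y) \<otimes> x \<ominus> (u \<otimes> x) \<otimes> y = \<zero>"
      using leibniz_identity[of u y x] assms u by simp
    then have "(u \<otimes> y) \<otimes> x = (u \<otimes> x) \<otimes> y"
      by (rule minus_eq_zeroD) (use assms u in auto)
    then show ?thesis
      using leibniz_identity[of u x y] assms u by simp
  qed
  then show ?thesis
    using assms by (simp add: right_annihilator_def)
qed

lemma finsum_mem_submodule:
  assumes "submodule class_ring N L" "finite A" "g \<in> A \<rightarrow> N"
  shows "(\<Oplus>i\<in>A. g i) \<in> N"
proof -
  interpret N: submodule class_ring N L by fact
  show ?thesis
    using assms(2,3) N.subset by (induction A) (auto simp: Pi_def subset_iff)
qed

lemma submodule_diff:
  assumes "submodule class_ring N L" "x \<oplus> y \<in> N" "y \<in> N" "x \<in> carrier L" "y \<in> carrier L"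
  shows "x \<in> N"
proof -
  have "(x \<oplus> y) \<oplus> (-1) \<odot> y \<in> N"
    using submodule.m_closed[OF assms(1,2)] submodule.smult_closed[OF assms(1) _ assms(3)] by simp
  moreover have "(x \<oplus> y) \<oplus> (-1) \<odot> y = x"
    using assms(4,5) by (simp add: smult_uminus a_assoc r_neg)
  ultimately show ?thesis
    by simp
qed

end

section \<open>The gradation\<close>

locale leibniz_graded = leibniz_algebra L for L :: "(complex, 'a) module" (structure) +
  fixes \<phi> :: "'a \<Rightarrow> nat \<Rightarrow> 'a set"
  assumes iso: "\<phi> \<in> alg_iso L (gr L)"
begin

text \<open>The component of \<open>x\<close> in degree \<open>i\<close>, a coset of \<open>L\<^sup>i\<^sup>+\<^sup>1\<close>, is zero iff it contains \<open>\<zero>\<close>.\<close>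

definition vanishing :: "nat \<Rightarrow> 'a set" where
  "vanishing i = {x \<in> carrier L. \<zero> \<in> \<phi> x i}"

text \<open>This is the preimage of \<open>gr_component L i\<close> under \<phi>. Working with it
  keeps the later computations in \<open>L\<close> instead of among families of cosets.\<close>

definition homogeneous :: "nat \<Rightarrow> 'a set" where
  "homogeneous i = {x \<in> carrier L. \<forall>j\<ge>1. j \<noteq> i \<longrightarrow> x \<in> vanishing j}"

lemma phi_coset:
  assumes "x \<in> carrier L" "i \<ge> 1"
  obtains u where "u \<in> lcs L i" "\<phi> x i = lcs L (Suc i) +>\<^bsub>L\<^esub> u"
proof -
  have "\<phi> x \<in> gr_carrier L"
    using iso assms(1) unfolding alg_iso_def bij_betw_def by (auto simp: gr_def)
  then have "\<phi> x i \<in> (\<lambda>x. lcs L (Suc i) +>\<^bsub>L\<^esub> x) ` lcs L i"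
    using assms(2) unfolding gr_carrier_def by (auto simp del: lcs.simps)
  then show ?thesis
    using that by blast
qed

lemma mem_lcs_coset: "x \<in> carrier L \<Longrightarrow> x \<in> lcs L k +>\<^bsub>L\<^esub> x"
  using zero_mem_lcs[of k] by (force simp: a_r_coset_def')

lemma phi_repr:
  assumes "x \<in> carrier L" "i \<ge> 1"
  obtains u where "u \<in> carrier L" "u \<in> \<phi> x i"
  using phi_coset[OF assms] mem_lcs_coset lcs_subset_carrier by (metis subsetD)

lemma phi_add:
  assumes "x \<in> carrier L" "y \<in> carrier L" "i \<ge> 1"
  shows "\<phi> (x \<oplus> y) i = \<phi> x i <+>\<^bsub>L\<^esub> \<phi> y i"
  using module_hom_add[of \<phi> class_ring L "gr L" x y] iso assms by (auto simp: alg_iso_def gr_def)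

lemma phi_smult:
  assumes "x \<in> carrier L" "i \<ge> 1"
  shows "\<phi> (c \<odot> x) i = lcs L (Suc i) <+>\<^bsub>L\<^esub> ((\<lambda>x. c \<odot> x) ` \<phi> x i)"
  using module_hom_smult[of \<phi> class_ring L "gr L" c x] iso assms
  by (auto simp: alg_iso_def gr_def simp del: lcs.simps)

lemma phi_add_mem:
  assumes "x \<in> carrier L" "y \<in> carrier L" "i \<ge> 1" "u \<in> \<phi> x i" "v \<in> \<phi> y i"
  shows "u \<oplus> v \<in> \<phi> (x \<oplus> y) i"
  using assms by (auto simp: phi_add set_add_def')

lemma phi_smult_mem:
  assumes "x \<in> carrier L" "i \<ge> 1" "u \<in> \<phi> x i" "u \<in> carrier L"
  shows "c \<odot> u \<in> \<phi> (c \<odot> x) i"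
proof -
  have "\<zero> \<oplus> c \<odot> u \<in> lcs L (Suc i) <+>\<^bsub>L\<^esub> ((\<lambda>x. c \<odot> x) ` \<phi> x i)"
    unfolding set_add_def' using zero_mem_lcs[of "Suc i"] assms(3) by blast
  then show ?thesis
    using assms by (simp add: phi_smult)
qed

lemma phi_eq_lcs_iff:
  assumes "x \<in> carrier L" "i \<ge> 1"
  shows "\<phi> x i = lcs L (Suc i) \<longleftrightarrow> x \<in> vanishing i"
proof
  show "x \<in> vanishing i" if "\<phi> x i = lcs L (Suc i)"
    using that assms zero_mem_lcs[of "Suc i"] by (simp add: vanishing_def)
next
  assume "x \<in> vanishing i"
  obtain u where u: "u \<in> lcs L i" "\<phi> x i = lcs L (Suc i) +>\<^bsub>L\<^esub> u"
    using phi_coset[OF assms] .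
  have "abelian_group L" ..
  moreover have "u \<in> carrier L"
    using u lcs_subset_carrier by auto
  ultimately show "\<phi> x i = lcs L (Suc i)"
    using a_r_coset_zero_mem submodule_additive_subgroup[OF lcs_submodule] \<open>x \<in> vanishing i\<close> u(2)
    by (metis (mono_tags, lifting) vanishing_def mem_Collect_eq)
qed

lemma mem_homogeneous_iff:
  assumes "x \<in> carrier L"
  shows "x \<in> homogeneous i \<longleftrightarrow> \<phi> x \<in> gr_component L i"
proof -
  have "\<phi> x \<in> carrier (gr L)"
    using iso assms unfolding alg_iso_def bij_betw_def by auto
  then show ?thesis
    using assms phi_eq_lcs_iff by (auto simp: homogeneous_def gr_component_def simp del: lcs.simps)
qed

lemma vanishing_submodule:
  assumes "i \<ge> 1"
  shows "submodule class_ring (vanishing i) L"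
proof
  show "vanishing i \<subseteq> carrier L"
    by (auto simp: vanishing_def)
  show "v \<oplus> w \<in> vanishing i" if "v \<in> vanishing i" "w \<in> vanishing i" for v w
    using that phi_add_mem[OF _ _ assms, of v w "\<zero>" "\<zero>"] by (auto simp: vanishing_def)
  show smult: "c \<odot> v \<in> vanishing i" if "v \<in> vanishing i" for c v
    using that phi_smult_mem[OF _ assms, of v "\<zero>"] by (auto simp: vanishing_def)
  \<comment> \<open>Preservation of zero is not part of the definition of a homomorphism; applying
    the scalar 0 to any representative of the class yields it.\<close>
  obtain u where u: "u \<in> carrier L" "u \<in> \<phi> \<zero> i"
    using phi_repr[OF M.zero_closed assms] .
  then show "\<zero> \<in> vanishing i"
    using phi_smult_mem[OF _ assms, of "\<zero>" u 0] lmult_0[of u] by (auto simp: vanishing_def)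
qed

lemma homogeneous_submodule: "submodule class_ring (homogeneous i) L"
proof
  show "homogeneous i \<subseteq> carrier L"
    by (auto simp: homogeneous_def)
  show "\<zero> \<in> homogeneous i"
    using submodule.zero_closed[OF vanishing_submodule] by (simp add: homogeneous_def)
  show "v \<oplus> w \<in> homogeneous i" if "v \<in> homogeneous i" "w \<in> homogeneous i" for v w
    using that submodule.m_closed[OF vanishing_submodule] by (simp add: homogeneous_def)
  show "c \<odot> v \<in> homogeneous i" if "v \<in> homogeneous i" for c v
    using that submodule.smult_closed[OF vanishing_submodule] by (simp add: homogeneous_def)
qed

text \<open>An element without nonzero components has the same image under \<phi> as
  \<open>\<zero>\<close>, and \<phi> is injective.\<close>

lemma eq_zero_of_mem_vanishing:
  assumes "x \<in> carrier L" "\<And>i. i \<ge> 1 \<Longrightarrow> x \<in> vanishing i"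
  shows "x = \<zero>"
proof -
  have "\<phi> x i = \<phi> \<zero> i" if "i \<ge> 1" for i
    using phi_eq_lcs_iff[OF _ that] assms that submodule.zero_closed[OF vanishing_submodule[OF that]]
    by (metis M.zero_closed)
  moreover have "\<phi> x \<in> gr_carrier L" "\<phi> \<zero> \<in> gr_carrier L"
    using iso assms unfolding alg_iso_def bij_betw_def by (auto simp: gr_def)
  ultimately have "\<phi> x = \<phi> \<zero>"
    unfolding gr_carrier_def by (auto intro!: PiE_ext[of _ "{1..}"] simp del: lcs.simps)
  then show ?thesis
    using iso assms(1) unfolding alg_iso_def bij_betw_def by (auto dest: inj_onD)
qed

text \<open>The bracket of the graded algebra is formed from all choices of representatives, so the
  class of a product may be computed with whichever representatives are convenient.\<close>

lemma phi_bracket_mem: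
  assumes "x \<in> carrier L" "y \<in> carrier L" "k \<ge> 1"
    and "\<And>i. i \<in> {1..<k} \<Longrightarrow> u i \<in> \<phi> x i" "\<And>i. i \<in> {1..<k} \<Longrightarrow> v i \<in> \<phi> y i"
    and "\<And>i. i \<in> {1..<k} \<Longrightarrow> u i \<in> carrier L" "\<And>i. i \<in> {1..<k} \<Longrightarrow> v i \<in> carrier L"
  shows "(\<Oplus>i\<in>{1..<k}. u i \<otimes> v (k - i)) \<in> \<phi> (x \<otimes> y) k"
proof -
  let ?s = "\<Oplus>i\<in>{1..<k}. u i \<otimes> v (k - i)"
  have "\<phi> (x \<otimes> y) = gr_bracket L (\<phi> x) (\<phi> y)"
    using iso assms(1,2) unfolding alg_iso_def by (simp add: gr_def)
  moreover have "\<zero> \<oplus> ?s \<in> lcs L (Suc k) <+>\<^bsub>L\<^esub>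
      {\<Oplus>i\<in>{1..<k}. x' i \<otimes> y' (k - i) | x' y'. \<forall>i\<in>{1..<k}. x' i \<in> \<phi> x i \<and> y' i \<in> \<phi> y i}"
    (is "_ \<in> _ <+>\<^bsub>L\<^esub> ?S")
  proof -
    have "?s \<in> ?S"
      using assms(4,5) by (intro CollectI exI[of _ u] exI[of _ v]) auto
    then show ?thesis
      unfolding set_add_def' using zero_mem_lcs[of "Suc k"] by blast
  qed
  then have "\<zero> \<oplus> ?s \<in> gr_bracket L (\<phi> x) (\<phi> y) k"
    unfolding gr_bracket_def using assms(3) by simp
  moreover have "?s \<in> carrier L"
    using assms(6,7) by (intro finsum_closed) (auto intro!: bracket_closed)
  ultimately show ?thesis
    by simp
qed

text \<open>For \<open>k = 1\<close> the convolution ranges over the empty set, so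
  \<open>\<zero>\<close> represents the degree 1 component of any product.\<close>

lemma bracket_mem_vanishing_1: "x \<in> carrier L \<Longrightarrow> y \<in> carrier L \<Longrightarrow> x \<otimes> y \<in> vanishing 1"
  using phi_bracket_mem[of x y 1] bracket_closed by (simp add: vanishing_def)

text \<open>Consequently a nonzero homogeneous element of degree 1 lies outside
  \<open>[L, L]\<close>, which makes it admissible in the definition of the characteristic
  sequence.\<close>

lemma bracket_span_subset_vanishing_1: "bracket_span L (carrier L) (carrier L) \<subseteq> vanishing 1"
  unfolding bracket_span_def using bracket_mem_vanishing_1 by (intro span_is_subset vanishing_submodule) auto

text \<open>Choosing the representative \<open>\<zero>\<close> in every degree but one makes all terms of the convolution vanish.\<close>

lemma homogeneous_bracket:
  assumes "x \<in> homogeneous i" "y \<in> homogeneous j"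
  shows "x \<otimes> y \<in> homogeneous (i + j)"
proof -
  have xy: "x \<in> carrier L" "y \<in> carrier L"
    using assms by (auto simp: homogeneous_def)
  have repr: "\<exists>u. u \<in> carrier L \<and> u \<in> \<phi> z k \<and> (k \<noteq> l \<longrightarrow> u = \<zero>)" if "z \<in> homogeneous l" "k \<ge> 1" for k l z
    using that phi_repr[of z k] by (cases "k = l") (auto simp: homogeneous_def vanishing_def)
  define u where "u k = (SOME u. u \<in> carrier L \<and> u \<in> \<phi> x k \<and> (k \<noteq> i \<longrightarrow> u = \<zero>))" for k
  define v where "v k = (SOME u. u \<in> carrier L \<and> u \<in> \<phi> y k \<and> (k \<noteq> j \<longrightarrow> u = \<zero>))" for k
  have u: "u k \<in> carrier L \<and> u k \<in> \<phi> x k \<and> (k \<noteq> i \<longrightarrow> u k = \<zero>)" if "k \<ge> 1" for k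
    unfolding u_def using someI_ex[OF repr[OF assms(1) that]] .
  have v: "v k \<in> carrier L \<and> v k \<in> \<phi> y k \<and> (k \<noteq> j \<longrightarrow> v k = \<zero>)" if "k \<ge> 1" for k
    unfolding v_def using someI_ex[OF repr[OF assms(2) that]] .
  have "x \<otimes> y \<in> vanishing k" if k: "k \<ge> 1" "k \<noteq> i + j" for k
  proof -
    have "u m \<otimes> v (k - m) = \<zero>" if "m \<in> {1..<k}" for m
    \<comment> \<open>If \<open>m = i\<close>, then \<open>k - m\<close> differs from
      \<open>j\<close> because \<open>k\<close> differs from \<open>i + j\<close>; so one of the two
      factors always has representative \<open>\<zero>\<close>.\<close>
    proof (cases "m = i")
      case True
      then have "v (k - m) = \<zero>"
        using v[of "k - m"] that k(2) by auto
      then show ?thesis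
        using u[of m] that by simp
    next
      case False
      then have "u m = \<zero>"
        using u[of m] that by simp
      then show ?thesis
        using v[of "k - m"] that by auto
    qed
    then have "(\<Oplus>m\<in>{1..<k}. u m \<otimes> v (k - m)) = \<zero>"
      by (intro add.finprod_one_eqI) auto
    then show ?thesis
      using phi_bracket_mem[OF xy k(1), of u v] u v bracket_closed[OF xy] by (auto simp: vanishing_def)
  qed
  then show ?thesis
    using bracket_closed[OF xy] by (simp add: homogeneous_def)
qed

text \<open>Since \<open>L\<^sup>1 = L\<close>, every \<open>a\<close> has a class in degree 1. The
  family with this class in degree 1 and zero elsewhere has a preimage because \<phi> is
  onto.\<close>

lemma homogeneous_1_repr:
  assumes "a \<in> carrier L"
  obtains x where "x \<in> homogeneous 1" "a \<in> \<phi> x 1"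
proof -
  define f where "f = (\<lambda>i\<in>{1..}. if i = 1 then lcs L (Suc 1) +>\<^bsub>L\<^esub> a else lcs L (Suc i))"
  have "lcs L k +>\<^bsub>L\<^esub> \<zero> = lcs L k" for k
    using a_coset_add_zero[OF lcs_subset_carrier] .
  then have "lcs L (Suc i) \<in> (\<lambda>x. lcs L (Suc i) +>\<^bsub>L\<^esub> x) ` lcs L i" for i
    using zero_mem_lcs[of i] by (metis image_eqI)
  moreover have "a \<in> lcs L 1"
    using assms by simp
  ultimately have "f \<in> (\<Pi>\<^sub>E i\<in>{1..}. (\<lambda>x. lcs L (Suc i) +>\<^bsub>L\<^esub> x) ` lcs L i)"
    unfolding f_def by (auto simp del: lcs.simps)
  moreover have "finite {i\<in>{1..}. f i \<noteq> lcs L (Suc i)}"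
    by (rule finite_subset[of _ "{1}"]) (auto simp: f_def simp del: lcs.simps)
  ultimately have f: "f \<in> carrier (gr L)"
    by (simp add: gr_def gr_carrier_def del: lcs.simps)
  moreover have "\<phi> ` carrier L = carrier (gr L)"
    using iso by (simp add: alg_iso_def bij_betw_def)
  ultimately obtain x where x: "x \<in> carrier L" "\<phi> x = f"
    by (metis imageE)
  have "f \<in> gr_component L 1"
    using f by (auto simp: gr_component_def f_def simp del: lcs.simps)
  then have "x \<in> homogeneous 1"
    using mem_homogeneous_iff x by auto
  moreover have "a \<in> \<phi> x 1"
    using x(2) mem_lcs_coset[OF assms] by (simp add: f_def del: lcs.simps)
  ultimately show ?thesis
    using that by blast
qed

text \<open>\<open>L\<^sup>2\<close> is spanned by products \<open>[a, b]\<close>, and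
  \<open>a\<close>, \<open>b\<close> represent homogeneous elements \<open>x\<close>,
  \<open>y\<close> of degree 1. So every class in degree 2 is the class of a combination of such
  \<open>[x, y]\<close>, and a homogeneous element is determined by its class.\<close>

lemma homogeneous_2_generated: "homogeneous 2 \<subseteq> span {x \<otimes> y | x y. x \<in> homogeneous 1 \<and> y \<in> homogeneous 1}"
proof
  fix g
  assume g: "g \<in> homogeneous 2"
  define G where "G = {x \<otimes> y | x y. x \<in> homogeneous 1 \<and> y \<in> homogeneous 1}"
  have V1: "homogeneous 1 \<subseteq> carrier L"
    by (auto simp: homogeneous_def)
  then have G: "G \<subseteq> carrier L"
    by (auto simp: G_def subset_iff)
  interpret G: submodule class_ring "span G" L
    using span_is_submodule[OF G] .
  \<comment> \<open>\<open>S\<close> consists of the elements that represent the degree 2 component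
    of some member of \<open>span G\<close>. It is a subspace containing all products, hence it
    contains \<open>L\<^sup>2\<close>.\<close>
  define S where "S = {u \<in> carrier L. \<exists>w\<in>span G. u \<in> \<phi> w 2}"
  have "submodule class_ring S L"
  proof
    show "S \<subseteq> carrier L"
      by (auto simp: S_def)
    show "\<zero> \<in> S"
      using submodule.zero_closed[OF vanishing_submodule[of 2]] G.zero_closed by (auto simp: S_def vanishing_def)
    show "v \<oplus> v' \<in> S" if S: "v \<in> S" "v' \<in> S" for v v'
    proof -
      obtain w w' where "w \<in> span G" "w' \<in> span G" "v \<in> \<phi> w 2" "v' \<in> \<phi> w' 2"
        using S by (auto simp: S_def)
      moreover from this have "v \<oplus> v' \<in> \<phi> (w \<oplus> w') 2"
        using phi_add_mem[of w w' 2 v v'] G.subset by (simp add: subset_iff)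
      ultimately show ?thesis
        using S by (auto simp: S_def)
    qed
    show "c \<odot> v \<in> S" if S: "v \<in> S" for c v
    proof -
      obtain w where "w \<in> span G" "v \<in> \<phi> w 2"
        using S by (auto simp: S_def)
      moreover from this have "c \<odot> v \<in> \<phi> (c \<odot> w) 2"
        using phi_smult_mem[of w 2 v c] G.subset S by (simp add: subset_iff S_def)
      ultimately show ?thesis
        using S G.smult_closed[of c w] smult_closed[of c v] by (auto simp: S_def)
    qed
  qed
  moreover have "a \<otimes> b \<in> S" if ab: "a \<in> carrier L" "b \<in> carrier L" for a b
  proof -
    obtain x y where xy: "x \<in> homogeneous 1" "y \<in> homogeneous 1" "a \<in> \<phi> x 1" "b \<in> \<phi> y 1"
      using homogeneous_1_repr ab by metis
    have *: "{1..<2} = {1::nat}"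
      by auto
    have "a \<otimes> b \<in> \<phi> (x \<otimes> y) 2"
      using phi_bracket_mem[of x y 2 "\<lambda>_. a" "\<lambda>_. b"] xy ab V1 bracket_closed[OF ab]
      unfolding * by (auto simp: subset_iff)
    moreover have "x \<otimes> y \<in> span G"
      using in_own_span[OF G] xy by (auto simp: G_def)
    ultimately show ?thesis
      using bracket_closed[OF ab] by (auto simp: S_def)
  qed
  ultimately have "lcs L 2 \<subseteq> S"
    using span_is_subset[of "{u \<otimes> v | u v. u \<in> carrier L \<and> v \<in> carrier L}" S]
    by (auto simp: numeral_2_eq_2 bracket_span_def)
  moreover obtain u where u: "u \<in> lcs L 2" "\<phi> g 2 = lcs L (Suc 2) +>\<^bsub>L\<^esub> u"
    using phi_coset[of g 2] g by (auto simp: homogeneous_def)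
  ultimately obtain w where w: "w \<in> span G" "u \<in> \<phi> w 2"
    by (auto simp: S_def)
  have carr: "g \<in> carrier L" "w \<in> carrier L" "u \<in> carrier L"
    using g w u lcs_subset_carrier G.subset by (auto simp: homogeneous_def)
  have neg: "x \<oplus> (-1) \<odot> x = \<zero>" if "x \<in> carrier L" for x
    using smult_l_distr[of 1 "-1" x] that smult_one[OF that] by simp
  \<comment> \<open>\<open>g\<close> and \<open>w\<close> are both homogeneous of degree 2 and share
    the representative \<open>u\<close> there, so their difference has no nonzero component at
    all.\<close>
  let ?z = "g \<oplus> (-1) \<odot> w"
  have "G \<subseteq> homogeneous 2"
    using homogeneous_bracket[of _ 1 _ 1] by (auto simp: G_def numeral_2_eq_2)
  then have "w \<in> homogeneous 2"
    using span_is_subset[OF _ homogeneous_submodule] w(1) by blast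
  then have "?z \<in> homogeneous 2"
    using g submodule.m_closed[OF homogeneous_submodule] submodule.smult_closed[OF homogeneous_submodule] by simp
  moreover have "u \<in> \<phi> g 2"
    using u(2) mem_lcs_coset carr by simp
  then have "u \<oplus> (-1) \<odot> u \<in> \<phi> ?z 2"
    using phi_add_mem[where i = 2] phi_smult_mem[where i = 2] w(2) carr by simp
  then have "?z \<in> vanishing 2"
    using neg[of u] carr by (auto simp: vanishing_def)
  ultimately have "?z = \<zero>"
    using eq_zero_of_mem_vanishing[of ?z] carr by (auto simp: homogeneous_def)
  then have "g = w"
    using minus_equality[OF _ carr(1), of "(-1) \<odot> w"] minus_equality[OF neg[OF carr(2)]] carr
      smult_closed[of "-1" w] by (metis M.add.m_comm M.minus_equality M.minus_minus UNIV_I partial_object.select_convs(1))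
  then show "g \<in> span {x \<otimes> y | x y. x \<in> homogeneous 1 \<and> y \<in> homogeneous 1}"
    using w(1) by (simp add: G_def)
qed

end

section \<open>Structure constants of an adapted basis\<close>

locale mu_algebra = leibniz_graded L \<phi> for L :: "(complex, 'a) module" (structure) and \<phi> +
  fixes n :: nat and e :: "nat \<Rightarrow> 'a"
  assumes n: "n \<ge> 6"
    and basis: "indexed_basis L e {1..n}"
    and shift: "i \<in> {1..n - 3} \<Longrightarrow> e i \<otimes> e 1 = e (i + 1)"
    and shift_zero: "i \<in> {n - 2, n - 1, n} \<Longrightarrow> e i \<otimes> e 1 = \<zero>"
    and degree: "i \<in> {1..n} \<Longrightarrow> e i \<in> homogeneous (if i = n - 1 then 1 else if i = n then 2 else i)"
begin

abbreviation deg :: "nat \<Rightarrow> nat" where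
  "deg i \<equiv> if i = n - 1 then 1 else if i = n then 2 else i"

lemma e_carrier [simp]: "i \<in> {1..n} \<Longrightarrow> e i \<in> carrier L"
  using indexed_basis_carrier[OF basis] .

lemma e_nonzero: "i \<in> {1..n} \<Longrightarrow> e i \<noteq> \<zero>"
proof
  assume i: "i \<in> {1..n}" "e i = \<zero>"
  then have "(\<Oplus>j\<in>{1..n}. (if j = i then 1 else 0) \<odot> e j) = \<zero>"
    by (intro add.finprod_one_eqI) auto
  then show False
    using indexed_basis_indep[OF basis _ _ i(1), of "\<lambda>j. if j = i then 1 else 0"] by simp
qed

lemma e_homogeneous: "i \<in> {1..n} \<Longrightarrow> k \<ge> 1 \<Longrightarrow> deg i \<noteq> k \<Longrightarrow> e i \<in> vanishing k"
  using degree[of i] by (simp add: homogeneous_def)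

text \<open>Split the sum into the part \<open>w\<close> of degree \<open>deg i\<close> and the rest
  \<open>r\<close>. In degree \<open>deg i\<close> both the sum and \<open>r\<close> vanish, hence
  so does \<open>w\<close>; in all other degrees \<open>w\<close> vanishes anyway. So
  \<open>w = \<zero>\<close>, and independence applies.\<close>

lemma homogeneous_coeff_zero:
  assumes "(\<Oplus>i\<in>{1..n}. c i \<odot> e i) \<in> homogeneous m" "i \<in> {1..n}" "deg i \<noteq> m"
  shows "c i = 0"
proof -
  let ?k = "deg i"
  define w where "w = (\<Oplus>j\<in>{1..n}. (if deg j = ?k then c j else 0) \<odot> e j)"
  define r where "r = (\<Oplus>j\<in>{1..n}. (if deg j = ?k then 0 else c j) \<odot> e j)"
  have k: "?k \<ge> 1"
    using assms(2) n by auto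
  have carr: "w \<in> carrier L" "r \<in> carrier L"
    by (auto simp: w_def r_def simp del: e_carrier intro!: finsum_closed smult_carrier e_carrier)
  have "w \<oplus> r = (\<Oplus>j\<in>{1..n}. (if deg j = ?k then c j else 0) \<odot> e j \<oplus> (if deg j = ?k then 0 else c j) \<odot> e j)"
    unfolding w_def r_def by (intro finsum_addf[symmetric]) auto
  also have "\<dots> = (\<Oplus>j\<in>{1..n}. c j \<odot> e j)"
    by (intro finsum_cong') (auto simp del: e_carrier simp: e_carrier)
  finally have sum: "w \<oplus> r \<in> homogeneous m"
    using assms(1) by simp
  have "w \<in> vanishing k'" if "k' \<ge> 1" for k'
  proof (cases "k' = ?k")
    case True
    have "r \<in> vanishing ?k"
      unfolding r_def using e_homogeneous[OF _ k] submodule.smult_closed[OF vanishing_submodule[OF k]]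
        submodule.zero_closed[OF vanishing_submodule[OF k]]
      by (intro finsum_mem_submodule[OF vanishing_submodule[OF k]]) auto
    moreover have "w \<oplus> r \<in> vanishing ?k"
      using sum assms(3) k by (simp add: homogeneous_def)
    ultimately show ?thesis
      using submodule_diff[OF vanishing_submodule[OF k] _ _ carr] True by simp
  next
    case False
    then show ?thesis
      unfolding w_def using e_homogeneous[OF _ that] submodule.smult_closed[OF vanishing_submodule[OF that]]
        submodule.zero_closed[OF vanishing_submodule[OF that]]
      by (intro finsum_mem_submodule[OF vanishing_submodule[OF that]]) auto
  qed
  then have "w = \<zero>"
    using eq_zero_of_mem_vanishing[OF carr(1)] by blast
  then show ?thesis
    using indexed_basis_indep[OF basis _ _ assms(2), of "\<lambda>j. if deg j = ?k then c j else 0"]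
    by (simp add: w_def)
qed

lemma homogeneous_repr:
  assumes "x \<in> homogeneous m"
  obtains c where "x = (\<Oplus>i\<in>{i \<in> {1..n}. deg i = m}. c i \<odot> e i)"
proof -
  have "x \<in> carrier L"
    using assms by (simp add: homogeneous_def)
  then obtain c where c: "x = (\<Oplus>i\<in>{1..n}. c i \<odot> e i)"
    using indexed_basis_repr[OF basis] by auto
  have "c i \<odot> e i = \<zero>" if "i \<in> {1..n} - {i \<in> {1..n}. deg i = m}" for i
  proof -
    have "i \<in> {1..n}" "deg i \<noteq> m"
      using that by auto
    then show ?thesis
      using homogeneous_coeff_zero[of c m i] assms unfolding c by simp
  qed
  then have "(\<Oplus>i\<in>{1..n}. c i \<odot> e i) = (\<Oplus>i\<in>{i \<in> {1..n}. deg i = m}. c i \<odot> e i)"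
  proof (intro add.finprod_mono_neutral_cong_right)
    show "(\<lambda>i. c i \<odot> e i) \<in> {1..n} \<rightarrow> carrier L"
      by (auto simp del: e_carrier simp: e_carrier)
  qed auto
  with c have "x = (\<Oplus>i\<in>{i \<in> {1..n}. deg i = m}. c i \<odot> e i)"
    by (rule trans)
  then show ?thesis
    by (rule that)
qed

abbreviation f :: 'a where "f \<equiv> e (n - 1)"
abbreviation g :: 'a where "g \<equiv> e n"

lemma fg_carrier [simp]: "e (Suc 0) \<in> carrier L" "e (n - Suc 0) \<in> carrier L" "e 2 \<in> carrier L" "f \<in> carrier L" "g \<in> carrier L"
  using n by auto

text \<open>The adapted basis has two members in degree 1 (\<open>e 1\<close>, \<open>f\<close>),
  two in degree 2 (\<open>e 2\<close>, \<open>g\<close>) and only \<open>e 3\<close> in degree 3; n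
  \<ge> 6 keeps these indices apart.\<close>

lemma homogeneous_1_cases:
  assumes "x \<in> homogeneous 1"
  obtains a b where "x = a \<odot> e 1 \<oplus> b \<odot> f"
proof -
  have "{i \<in> {1..n}. deg i = 1} = {1, n - 1}"
    using n by auto
  then show ?thesis
    using homogeneous_repr[OF assms] that n by (auto simp: finsum_insert)
qed

lemma homogeneous_2_cases:
  assumes "x \<in> homogeneous 2"
  obtains a b where "x = a \<odot> e 2 \<oplus> b \<odot> g"
proof -
  have "{i \<in> {1..n}. deg i = 2} = {2, n}"
    using n by auto
  then show ?thesis
    using homogeneous_repr[OF assms] that n by (auto simp: finsum_insert)
qed

lemma homogeneous_3_cases:
  assumes "x \<in> homogeneous 3"
  obtains a where "x = a \<odot> e 3"
proof -
  have "{i \<in> {1..n}. deg i = 3} = {3}"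
    using n by auto
  then show ?thesis
    using homogeneous_repr[OF assms] that n by (auto simp: finsum_insert)
qed

lemma e_degree_small: "e 1 \<in> homogeneous 1" "f \<in> homogeneous 1" "g \<in> homogeneous 2"
proof -
  have "1 \<noteq> n - 1" "n \<noteq> n - 1"
    using n by auto
  then show "e 1 \<in> homogeneous 1" "f \<in> homogeneous 1" "g \<in> homogeneous 2"
    using degree[of 1] degree[of "n - 1"] degree[of n] n by auto
qed

lemma f_e1: "f \<otimes> e 1 = \<zero>" and g_e1: "g \<otimes> e 1 = \<zero>"
  using shift_zero by auto

text \<open>\<open>e 2\<close> is the square of \<open>e 1\<close>, and each further
  \<open>e i\<close> arises from it by right multiplications with \<open>e 1\<close>.\<close>

lemma e_right_annihilator:
  assumes "2 \<le> i" "i \<le> n - 2"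
  shows "e i \<in> right_annihilator"
  using assms
proof (induction i rule: dec_induct)
  case base
  have "e 1 \<otimes> e 1 = e 2"
    using shift[of 1] n by (simp add: numeral_2_eq_2)
  then show ?case
    using square_right_annihilator[of "e 1"] by simp
next
  case (step i)
  then have "e i \<otimes> e 1 = e (Suc i)"
    using shift[of i] n by auto
  then show ?case
    using step bracket_right_annihilator[of "e i" "e 1"] by auto
qed

text \<open>The degrees leave unknowns \<open>a\<close>, \<open>b\<close>, \<open>c\<close>,
  \<open>d\<close>, \<open>t\<close> in the products with \<open>f\<close>. Commutation of the right
  multiplications by \<open>e 1\<close> and \<open>f\<close>, tested on \<open>f\<close>,
  \<open>g\<close> and the \<open>e i\<close>, removes \<open>c\<close> and \<open>t\<close> and
  propagates \<open>a\<close> along the chain.\<close>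

lemma structure_constants:
  "\<exists>a b d. (b, d) \<noteq> (0, 0) \<and> e 1 \<otimes> f = a \<odot> e 2 \<oplus> b \<odot> g \<and> f \<otimes> f = d \<odot> g \<and>
    g \<otimes> f = \<zero> \<and> e (n - 2) \<otimes> f = \<zero> \<and> (\<forall>i\<in>{2..n - 3}. e i \<otimes> f = a \<odot> e (i + 1)) \<and>
    (\<forall>i\<in>{1..n}. \<forall>j\<in>{1..n} - {1, n - 1}. e i \<otimes> e j = \<zero>)"
proof -
  interpret Z: submodule class_ring right_annihilator L
    by (rule right_annihilator_submodule)
  have "e 1 \<otimes> f \<in> homogeneous 2" "f \<otimes> f \<in> homogeneous 2" "g \<otimes> f \<in> homogeneous 3"
    using homogeneous_bracket[OF e_degree_small(1,2)] homogeneous_bracket[OF e_degree_small(2,2)] homogeneous_bracket[OF e_degree_small(3,2)]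
    by (simp_all add: numeral_2_eq_2 numeral_3_eq_3)
  note products = this
  obtain a b where ab: "e 1 \<otimes> f = a \<odot> e 2 \<oplus> b \<odot> g"
    using homogeneous_2_cases[OF products(1)] .
  obtain c d where cd: "f \<otimes> f = c \<odot> e 2 \<oplus> d \<odot> g"
    using homogeneous_2_cases[OF products(2)] .
  obtain t where t: "g \<otimes> f = t \<odot> e 3"
    using homogeneous_3_cases[OF products(3)] .
  have e1_e1: "e 1 \<otimes> e 1 = e 2"
    using shift[of 1] n by (simp add: numeral_2_eq_2)
  \<comment> \<open>Otherwise all products of degree 1 elements would lie on the line through
    \<open>e 2\<close>; as these products span degree 2, \<open>g\<close> would be a multiple of
    \<open>e 2\<close>.\<close>
  have bd: "(b, d) \<noteq> (0, 0)"
  proof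
    assume bd: "(b, d) = (0, 0)"
    define N where "N = {k \<odot> e 2 | k. True}"
    have N: "submodule class_ring N L"
    proof
      show "N \<subseteq> carrier L"
        by (auto simp: N_def)
      show "\<zero> \<in> N"
        unfolding N_def by (intro CollectI exI[of _ 0]) simp
      show "v \<oplus> w \<in> N" if vw: "v \<in> N" "w \<in> N" for v w
        using vw unfolding N_def by (auto simp: smult_add_left[symmetric])
      show "k \<odot> v \<in> N" if "v \<in> N" for k v
        using that unfolding N_def by (auto simp: smult_mult[symmetric])
    qed
    interpret N: submodule class_ring N L
      by (rule N)
    have mem: "k \<odot> e 2 \<in> N" for k
      by (auto simp: N_def)
    have "x \<otimes> y \<in> N" if xy: "x \<in> homogeneous 1" "y \<in> homogeneous 1" for x y
    proof -
      obtain a1 b1 a2 b2 where *: "x = a1 \<odot> e 1 \<oplus> b1 \<odot> f" "y = a2 \<odot> e 1 \<oplus> b2 \<odot> f"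
        using homogeneous_1_cases[OF xy(1)] homogeneous_1_cases[OF xy(2)] by metis
      have "e 1 \<otimes> e 1 \<in> N" "e 1 \<otimes> f \<in> N" "f \<otimes> e 1 \<in> N" "f \<otimes> f \<in> N"
        using mem[of 1] mem[of a] mem[of c] N.zero_closed bd ab cd f_e1 e1_e1 by auto
      then show ?thesis
        unfolding * by (auto simp: bracket_add_left bracket_add_right bracket_smult_left bracket_smult_right)
    qed
    then have "g \<in> N"
      using homogeneous_2_generated e_degree_small(3) span_is_subset[OF _ N, of "{x \<otimes> y |x y. x \<in> homogeneous 1 \<and> y \<in> homogeneous 1}"] by blast
    then obtain k where k: "g = k \<odot> e 2"
      by (auto simp: N_def)
    have "(\<Oplus>i\<in>{1..n}. (if i = 2 then k else if i = n then -1 else 0) \<odot> e i)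
        = (\<Oplus>i\<in>{2, n}. (if i = 2 then k else if i = n then -1 else 0) \<odot> e i)"
      using n by (intro add.finprod_mono_neutral_cong_right) (auto simp del: e_carrier simp: e_carrier)
    also have "\<dots> = \<zero>"
      using n k by (simp add: finsum_insert smult_uminus r_neg)
    finally show False
      using indexed_basis_indep[OF basis, of "\<lambda>i. if i = 2 then k else if i = n then -1 else 0" n] n by auto
  qed
  have e2: "e 2 \<in> right_annihilator"
    using e_right_annihilator[of 2] n by simp
  have e1f: "e 1 \<otimes> f \<in> right_annihilator"
    using bracket_mem_right_annihilator[OF f_e1] n by simp
  \<comment> \<open>Subtracting the multiples of \<open>e 2\<close> from
    \<open>[e\<^sub>1, f]\<close> and \<open>[f, f]\<close> leaves \<open>b g\<close> and
    \<open>d g\<close>; one of the two scalars is nonzero and can be divided out.\<close>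
  have "b \<odot> g \<in> right_annihilator"
    using submodule_diff[OF right_annihilator_submodule, of "b \<odot> g" "a \<odot> e 2"] e1f ab e2 
    by (simp add: a_comm)
  moreover have "d \<odot> g \<in> right_annihilator"
    using submodule_diff[OF right_annihilator_submodule, of "d \<odot> g" "c \<odot> e 2"]
      square_right_annihilator[of f] cd e2 
    by (simp add: a_comm)
  moreover have "g \<in> right_annihilator" if "k \<noteq> 0" "k \<odot> g \<in> right_annihilator" for k
    using Z.smult_closed[OF _ that(2), of "inverse k"] that(1) by (simp add: smult_mult[symmetric])
  ultimately have g: "g \<in> right_annihilator"
    using bd by auto
  have commute: "(u \<otimes> e 1) \<otimes> f = (u \<otimes> f) \<otimes> e 1" if "u \<in> carrier L" for u
    using right_mult_commute[OF e1f that] by simp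
  have shift2: "e 2 \<otimes> e 1 = e 3" "e 3 \<otimes> e 1 = e 4"
    using shift[of 2] shift[of 3] n by (simp_all add: numeral_eq_Suc)
  have e34: "e 3 \<in> carrier L" "e 4 \<in> carrier L" "e 3 \<noteq> \<zero>" "e 4 \<noteq> \<zero>"
    using n e_nonzero[of 3] e_nonzero[of 4] by auto
  \<comment> \<open>Commutation tested on \<open>f\<close>, where \<open>[f, e\<^sub>1] = 0\<close>.
    The test on \<open>g\<close> below finds \<open>t\<close> in the same way as the coefficient of
    \<open>e 4\<close>.\<close>
  have "c \<odot> e 3 = (f \<otimes> f) \<otimes> e 1"
    using cd shift2 g_e1 e34 by (simp add: bracket_add_left bracket_smult_left)
  also have "\<dots> = \<zero>"
    using commute[of f] f_e1 by simp
  finally have "c = 0"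
    using e34 smult_eq_zero_iff by simp
  then have ff: "f \<otimes> f = d \<odot> g"
    using cd by simp
  have "t \<odot> e 4 = (g \<otimes> f) \<otimes> e 1"
    using t shift2 e34 by (simp add: bracket_smult_left)
  also have "\<dots> = \<zero>"
    using commute[of g] g_e1 by simp
  finally have "t = 0"
    using e34 smult_eq_zero_iff by simp
  then have gf: "g \<otimes> f = \<zero>"
    using t e34 by simp
  have ef: "e i \<otimes> f = a \<odot> e (i + 1)" if "2 \<le> i" "i \<le> n - 3" for i
    using that
  proof (induction i rule: dec_induct)
    case base
    have "e 2 \<otimes> f = (e 1 \<otimes> f) \<otimes> e 1"
      using commute[of "e 1"] e1_e1 by simp
    then show ?case
      using ab shift2 g_e1 e34 by (simp add: bracket_add_left bracket_smult_left numeral_3_eq_3)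
  next
    case (step i)
    then have i: "e i \<otimes> e 1 = e (Suc i)" "e (Suc i) \<otimes> e 1 = e (Suc (Suc i))" "e i \<in> carrier L" "e (Suc i) \<in> carrier L"
      using shift[of i] shift[of "Suc i"] by auto
    have "e (Suc i) \<otimes> f = (e i \<otimes> f) \<otimes> e 1"
      using commute[of "e i"] i by simp
    then show ?case
      using step i by (simp add: bracket_smult_left)
  qed
  have "e (n - 3) \<otimes> e 1 = e (n - 2)"
    using shift[of "n - 3"] n by (simp add: Suc_diff_Suc numeral_3_eq_3 numeral_2_eq_2)
  \<comment> \<open>Commutation at the last link: \<open>e (n - 2)\<close> is
    \<open>[e (n - 3), e 1]\<close>, and one more multiplication by \<open>e 1\<close> leaves the
    chain.\<close>
  then have "e (n - 2) \<otimes> f = a \<odot> (e (n - 2) \<otimes> e 1)"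
    using commute[of "e (n - 3)"] ef[of "n - 3"] n by (simp add: bracket_smult_left Suc_diff_Suc numeral_3_eq_3 numeral_2_eq_2)
  then have "e (n - 2) \<otimes> f = \<zero>"
    using shift_zero by simp
  moreover have zero: "e i \<otimes> e j = \<zero>" if ij: "i \<in> {1..n}" "j \<in> {1..n} - {1, n - 1}" for i j
  proof -
    have "j = n \<or> j \<in> {2..n - 2}"
      using ij by auto
    then have "e j \<in> right_annihilator"
      using g e_right_annihilator by auto
    then show ?thesis
      using ij(1) by (simp add: right_annihilator_def)
  qed
  ultimately show ?thesis
    using bd ab ff gf ef by (intro exI[of _ a] exI[of _ b] exI[of _ d] conjI ballI) simp_all
qed

end

section \<open>Nilpotent operators with two Jordan blocks\<close>

lemma jordan_matrix_two_blocks_index: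
  assumes "i < p + q" "j < p + q"
  shows "jordan_matrix [(p, 0), (q, 0)] $$ (i, j) = (if j = Suc i \<and> j \<noteq> p then 1 else 0 :: complex)"
  using assms by (auto simp: jordan_matrix_Cons jordan_block_def Let_def)

text \<open>These are the positions of the reversed Jordan basis used below: \<open>f\<close>, a
  multiple of \<open>g\<close>, \<open>e 1\<close>, its image, and then at \<open>n - 2 - i\<close>
  a multiple of \<open>e i\<close>. Writing \<open>n\<close> as \<open>m + 6\<close> removes
  truncated subtraction.\<close>

lemma index_cases: assumes j: "(j::nat) < n" and n: "n \<ge> 6" shows "j = n - 1 \<or> j = n - 2 \<or> j = n - 3 \<or> j = n - 4 \<or> (\<exists>i. 3 \<le> i \<and> i \<le> n - 2 \<and> j = n - 2 - i)"
proof -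
  obtain m where "n = m + 6" using n by (metis add.commute le_iff_add)
  then have "j = m + 5 \<or> j = m + 4 \<or> j = m + 3 \<or> j = m + 2 \<or> (3 \<le> m + 4 - j \<and> m + 4 - j \<le> m + 4 \<and> j = m + 4 - (m + 4 - j))"
    using j by auto
  then show ?thesis using \<open>n = m + 6\<close> by (auto simp del: One_nat_def)
qed
context leibniz_algebra
begin

text \<open>Column \<open>j\<close> of the matrix has its only nonzero entry in row
  \<open>j - 1\<close>, except for the columns 0 and \<open>p\<close>, where a block begins and the
  column is zero.\<close>

lemma jordan_sizes_two_blocksI:
  assumes basis: "indexed_basis L b {..<p + q}" and pq: "p \<ge> q" "q > 0"
    and T: "\<And>j. j < p + q \<Longrightarrow> T (b j) = (if j = 0 \<or> j = p then \<zero> else b (j - 1))"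
  shows "jordan_sizes L T [p, q]"
proof -
  have "T (b j) = (\<Oplus>i\<in>{..<p + q}. (jordan_matrix [(p, 0), (q, 0)] $$ (i, j)) \<odot> b i)"
    if j: "j < p + q" for j
  proof -
    have b: "b i \<in> carrier L" if "i < p + q" for i
      using indexed_basis_carrier[OF basis] that by simp
    have "(\<Oplus>i\<in>{..<p + q}. (jordan_matrix [(p, 0), (q, 0)] $$ (i, j)) \<odot> b i)
        = (\<Oplus>i\<in>(if j = 0 \<or> j = p then {} else {j - 1}). b i)"
      using j b jordan_matrix_two_blocks_index[OF _ j]
      by (intro add.finprod_mono_neutral_cong_right) (auto split: if_splits)
    also have "\<dots> = T (b j)"
      using T[OF j] b[of "j - 1"] j by (auto simp: finsum_insert)
    finally show ?thesis
      by simp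
  qed
  then show ?thesis
    using basis pq unfolding jordan_sizes_def by auto
qed

end

context mu_algebra
begin

lemma dim_n: "dim = n"
  using indexed_basis_dim[OF basis] by simp

text \<open>With \<open>x = e\<^sub>1 + \<beta> f\<close> and \<open>\<kappa> = 1 + \<beta> a \<noteq> 0\<close>, the chains of \<open>R\<^sub>x\<close> start at \<open>e\<^sub>1\<close> and \<open>f\<close>. A Jordan
  basis lists each chain backwards, because the superdiagonal ones map \<open>B j\<close> to \<open>B (j - 1)\<close>.\<close>

lemma square_coefficient_zero:
  assumes filiform: "two_filiform L"
    and e1f: "e 1 \<otimes> f = a \<odot> e 2 \<oplus> b \<odot> g" and ff: "f \<otimes> f = d \<odot> g" and gf: "g \<otimes> f = \<zero>"
    and last: "e (n - 2) \<otimes> f = \<zero>"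
    and ef: "\<And>i. i \<in> {2..n - 3} \<Longrightarrow> e i \<otimes> f = a \<odot> e (i + 1)"
  shows "d = 0"
proof (rule ccontr)
  assume d: "d \<noteq> 0"
  \<comment> \<open>Any nonzero \<beta> with \<open>1 + \<beta> * a \<noteq> 0\<close> would do: 1
    works unless \<open>a = -1\<close>, and then 2 gives \<kappa> = -1.\<close>
  define \<beta> :: complex where "\<beta> = (if a = -1 then 2 else 1)"
  define \<kappa> where "\<kappa> = 1 + \<beta> * a"
  have nz: "\<beta> \<noteq> 0" "\<kappa> \<noteq> 0"
    by (auto simp: \<beta>_def \<kappa>_def add_eq_0_iff)
  define x where "x = e 1 \<oplus> \<beta> \<odot> f"
  have x: "x \<in> carrier L"
    by (simp add: x_def)
  have mult_x: "u \<otimes> x = u \<otimes> e 1 \<oplus> \<beta> \<odot> (u \<otimes> f)" if "u \<in> carrier L" for u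
    using that by (simp add: x_def bracket_add_right bracket_smult_right)
  have "e 1 \<otimes> e 1 = e 2"
    using shift[of 1] n by (simp add: numeral_2_eq_2)
  then have e1x: "e 1 \<otimes> x = \<kappa> \<odot> e 2 \<oplus> (\<beta> * b) \<odot> g"
    using e1f mult_x[of "e 1"]
    by (simp add: \<kappa>_def smult_add_left smult_add_right smult_mult a_assoc)
  have eix: "e i \<otimes> x = \<kappa> \<odot> e (i + 1)" if "i \<in> {2..n - 3}" for i
  proof -
    have "e i \<otimes> e 1 = e (i + 1)" "e i \<in> carrier L" "e (i + 1) \<in> carrier L"
      using shift[of i] that by auto
    then show ?thesis
      using ef[OF that] mult_x[of "e i"] by (simp add: \<kappa>_def smult_add_left smult_mult)
  qed
  have lastx: "e (n - 2) \<otimes> x = \<zero>"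
    using last mult_x[of "e (n - 2)"] shift_zero[of "n - 2"] n by simp
  have fx: "f \<otimes> x = (\<beta> * d) \<odot> g"
    using ff mult_x[of f] f_e1 by (simp add: smult_mult)
  have gx: "g \<otimes> x = \<zero>"
    using gf mult_x[of g] g_e1 by simp
  \<comment> \<open>The last two positions hold the chain \<open>f\<close>, \<open>[f, x]\<close>.
    Below them runs the chain of \<open>e 1\<close>: its image still has a component along
    \<open>g\<close>, which the next step kills, so \<open>e i\<close> with \<open>i \<ge> 3\<close>
    appears at \<open>n - 2 - i\<close> with factor \<open>\<kappa> ^ (i - 1)\<close>.\<close>
  define B where "B j = (if j = n - 1 then f else if j = n - 2 then (\<beta> * d) \<odot> g
    else if j = n - 3 then e 1 else if j = n - 4 then \<kappa> \<odot> e 2 \<oplus> (\<beta> * b) \<odot> g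
    else \<kappa> ^ (n - 3 - j) \<odot> e (n - 2 - j))" for j
  have ne: "n - 2 \<noteq> n - 1" "n - 3 \<noteq> n - 1" "n - 3 \<noteq> n - 2" "n - 4 \<noteq> n - 1" "n - 4 \<noteq> n - 2"
    "n - 4 \<noteq> n - 3" "n - 1 \<noteq> 0" "n - 2 \<noteq> 0" "n - 3 \<noteq> 0" "n - 4 \<noteq> 0"
    using n by linarith+
  have pred: "n - 1 - 1 = n - 2" "n - 3 - 1 = n - 4" "n - 4 - 1 = n - 5"
    by simp_all
  have B: "B (n - 1) = f" "B (n - 2) = (\<beta> * d) \<odot> g" "B (n - 3) = e 1"
    "B (n - 4) = \<kappa> \<odot> e 2 \<oplus> (\<beta> * b) \<odot> g"
    using ne by (simp_all only: B_def if_True if_False simp_thms)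
  have B_small: "B j = \<kappa> ^ (i - 1) \<odot> e i" if "3 \<le> i" "i \<le> n - 2" "j = n - 2 - i" for i j
  proof -
    have "j \<noteq> n - 1" "j \<noteq> n - 2" "j \<noteq> n - 3" "j \<noteq> n - 4" "n - 3 - j = i - 1" "n - 2 - j = i"
      using that n by linarith+
    then show ?thesis
      by (simp only: B_def if_False)
  qed
  have B_cases: "j = n - 1 \<or> j = n - 2 \<or> j = n - 3 \<or> j = n - 4
      \<or> (\<exists>i. 3 \<le> i \<and> i \<le> n - 2 \<and> j = n - 2 - i)" if "j < n" for j
    using index_cases[OF that n] .
  have e_carrier': "e i \<in> carrier L" if "1 \<le> i" "i \<le> n" for i
    using that by simp
  have B_carrier: "B j \<in> carrier L" if j: "j < n" for j
    using B_cases[OF j]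
  proof (elim disjE exE conjE)
    fix i
    assume "3 \<le> i" "i \<le> n - 2" "j = n - 2 - i"
    then show ?thesis
      using B_small e_carrier'[of i] by simp
  qed (simp_all only: B, simp_all)
  have B_mult: "B j \<otimes> x = (if j = 0 \<or> j = n - 2 then \<zero> else B (j - 1))" if j: "j < n" for j
  proof -
    have last: "B j \<otimes> x = \<zero>" if "j = 0 \<or> j = n - 2"
      using that
    proof
      assume "j = n - 2"
      then show ?thesis
        using gx x by (simp only: B(2)) (simp add: bracket_smult_left)
    next
      assume "j = 0"
      then have "B j = \<kappa> ^ (n - 2 - 1) \<odot> e (n - 2)"
        using B_small[of "n - 2" j] n by linarith
      then show ?thesis
        using lastx x e_carrier'[of "n - 2"] n by (simp add: bracket_smult_left)
    qed
    have step: "B j \<otimes> x = B (j - 1)" if ne0: "j \<noteq> 0" "j \<noteq> n - 2"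
      using B_cases[OF j]
    proof (elim disjE exE conjE)
      assume "j = n - 1"
      then show ?thesis
        by (simp only: B pred fx)
    next
      assume "j = n - 2"
      then show ?thesis
        using ne0 by simp
    next
      assume "j = n - 3"
      then show ?thesis
        by (simp only: B pred e1x)
    next
      assume j: "j = n - 4"
      have "B (n - 5) = \<kappa> ^ (3 - 1) \<odot> e 3"
        by (rule B_small) (use n in linarith)+
      then have "B (n - 5) = (\<kappa> * \<kappa>) \<odot> e 3"
        by (simp add: power2_eq_square)
      moreover have "(\<kappa> \<odot> e 2 \<oplus> (\<beta> * b) \<odot> g) \<otimes> x = (\<kappa> * \<kappa>) \<odot> e 3"
        using gx x eix[of 2] n e_carrier'[of 3]
        by (simp add: bracket_add_left bracket_smult_left smult_mult)
      ultimately show ?thesis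
        by (simp only: j pred B)
    next
      fix i
      assume i: "3 \<le> i" "i \<le> n - 2" "j = n - 2 - i"
      then have Bi: "B j = \<kappa> ^ (i - 1) \<odot> e i"
        by (rule B_small)
      have i': "3 \<le> i + 1" "i + 1 \<le> n - 2" "j - 1 = n - 2 - (i + 1)" "i + 1 \<le> n" "1 \<le> i" "2 \<le> i" "i \<le> n - 3" "i \<le> n"
        using i ne0 by linarith+
      have "B (j - 1) = \<kappa> ^ (i + 1 - 1) \<odot> e (i + 1)"
        using i' by (intro B_small)
      moreover have "\<kappa> ^ (i + 1 - 1) = \<kappa> ^ (i - 1) * \<kappa>"
        using i'(5) by (simp add: power_eq_if)
      moreover have "e i \<otimes> x = \<kappa> \<odot> e (i + 1)"
        using eix[of i] i' by simp
      ultimately show ?thesis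
        using Bi x e_carrier'[OF i'(5,8)] e_carrier'[OF _ i'(4)]
        by (simp add: bracket_smult_left smult_mult)
    qed
    show ?thesis
      using last step by (cases "j = 0 \<or> j = n - 2") simp_all
  qed
  define S where "S = span (B ` {..<n})"
  have BS: "B ` {..<n} \<subseteq> carrier L"
    using B_carrier by auto
  have S: "submodule class_ring S L"
    unfolding S_def by (rule span_is_submodule[OF BS])
  have B_mem: "B j \<in> S" if "j < n" for j
    using in_own_span[OF BS] that by (auto simp: S_def)
  \<comment> \<open>This is where \<open>d \<noteq> 0\<close> enters. Once \<open>g\<close> is in
    the span, subtracting its multiple gives \<open>e 2\<close>, and the other basis vectors follow
    by division by powers of \<kappa>.\<close>
  have "g \<in> S"
    using B_mem[of "n - 2"] n d nz span_smult_mem[OF BS, of g "\<beta> * d"] by (simp add: B S_def)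
  have "e i \<in> S" if i: "i \<in> {1..n}" for i
  proof -
    have "i = n \<or> i = n - 1 \<or> i = 1 \<or> i = 2 \<or> (3 \<le> i \<and> i \<le> n - 2)"
      using i unfolding atLeastAtMost_iff by presburger
    then consider "i = n" | "i = n - 1" | "i = 1" | "i = 2" | "3 \<le> i" "i \<le> n - 2"
      by blast
    then show ?thesis
    proof cases
      case 1
      then show ?thesis using \<open>g \<in> S\<close> by simp
    next
      case 2
      then show ?thesis using B_mem[of "n - 1"] B(1) n by simp
    next
      case 3
      then show ?thesis using B_mem[of "n - 3"] B(3) n by simp
    next
      case 4
      have "\<kappa> \<odot> e 2 \<oplus> (\<beta> * b) \<odot> g \<in> S"
        using B_mem[of "n - 4"] B(4) n by simp
      then have "\<kappa> \<odot> e 2 \<in> S"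
        using submodule_diff[OF S] submodule.smult_closed[OF S _ \<open>g \<in> S\<close>] by simp
      then show ?thesis
        using 4 span_smult_mem[OF BS, of "e 2" \<kappa>] nz by (simp add: S_def)
    next
      case 5
      then have "\<kappa> ^ (i - 1) \<odot> e i \<in> S"
        using B_mem[of "n - 2 - i"] B_small[of i "n - 2 - i"] n by simp
      then show ?thesis
        using span_smult_mem[OF BS, of "e i" "\<kappa> ^ (i - 1)"] nz i by (simp add: S_def)
    qed
  qed
  then have B_basis: "indexed_basis L B {..<n}"
    using indexed_basisI[OF basis, of "{..<n}" B] B_carrier by (simp add: S_def)
  have n2: "n - 2 + 2 = n"
    using n by simp
  have "jordan_sizes L (right_mult L x) [n - 2, 2]"
  proof (rule jordan_sizes_two_blocksI)
    show "indexed_basis L B {..<n - 2 + 2}"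
      using B_basis by (simp only: n2)
    show "right_mult L x (B j) = (if j = 0 \<or> j = n - 2 then \<zero> else B (j - 1))" if "j < n - 2 + 2" for j
      using B_mult[of j] that by (simp only: n2 right_mult_def)
  qed (use n in simp_all)
  \<comment> \<open>\<open>x\<close> is homogeneous of degree 1, so inside \<open>[L, L]\<close> it
    would be zero, against \<open>[f, x] \<noteq> 0\<close>.\<close>
  moreover have "x \<notin> bracket_span L (carrier L) (carrier L)"
  proof
    assume "x \<in> bracket_span L (carrier L) (carrier L)"
    then have "x \<in> vanishing 1"
      using bracket_span_subset_vanishing_1 by auto
    moreover have "x \<in> homogeneous 1"
      unfolding x_def using e_degree_small submodule.m_closed[OF homogeneous_submodule] submodule.smult_closed[OF homogeneous_submodule] by simp
    ultimately have "x = \<zero>"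
      using eq_zero_of_mem_vanishing[OF x] by (auto simp: homogeneous_def)
    then have "f \<otimes> x = \<zero>"
      by simp
    then have "(\<beta> * d) \<odot> g = \<zero>"
      by (simp only: fx)
    then show False
      using smult_eq_zero_iff[of g "\<beta> * d"] nz d e_nonzero[of n] n by simp
  qed
  moreover have "\<forall>x\<in>carrier L - bracket_span L (carrier L) (carrier L). \<forall>t.
      jordan_sizes L (right_mult L x) t \<longrightarrow> t = [n - 2, 1, 1] \<or> (t, [n - 2, 1, 1]) \<in> lexord less_than"
    using filiform unfolding two_filiform_def char_sequence_def dim_n by blast
  \<comment> \<open>The second entry decides: 2 exceeds 1, so the sequence found is
    lexicographically above the maximum.\<close>
  ultimately have "[n - 2, 2] = [n - 2, 1, 1] \<or> ([n - 2, 2], [n - 2, 1, 1]) \<in> lexord less_than"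
    using x by blast
  then show False
    by simp
qed

end

section \<open>Isomorphisms onto table algebras\<close>

text \<open>Each identity for the inverse is checked after applying \<psi>, which is injective; the
  closure assumptions ensure that both sides lie in \<open>M\<close>.\<close>

lemma alg_isomorphic_sym:
  fixes M :: "(complex, 'b) module" and L :: "(complex, 'a) module"
  assumes \<psi>: "\<psi> \<in> alg_iso M L"
    and closed: "\<And>x y. x \<in> carrier M \<Longrightarrow> y \<in> carrier M \<Longrightarrow> x \<oplus>\<^bsub>M\<^esub> y \<in> carrier M"
      "\<And>c x. x \<in> carrier M \<Longrightarrow> c \<odot>\<^bsub>M\<^esub> x \<in> carrier M"
      "\<And>x y. x \<in> carrier M \<Longrightarrow> y \<in> carrier M \<Longrightarrow> x \<otimes>\<^bsub>M\<^esub> y \<in> carrier M"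
  shows "alg_isomorphic L M"
proof -
  let ?\<phi> = "inv_into (carrier M) \<psi>"
  have bij: "bij_betw \<psi> (carrier M) (carrier L)"
    and hom: "\<psi> \<in> module_hom class_ring M L"
    and mult: "\<And>x y. x \<in> carrier M \<Longrightarrow> y \<in> carrier M \<Longrightarrow> \<psi> (x \<otimes>\<^bsub>M\<^esub> y) = \<psi> x \<otimes>\<^bsub>L\<^esub> \<psi> y"
    using \<psi> by (auto simp: alg_iso_def)
  have inv: "?\<phi> x \<in> carrier M" "\<psi> (?\<phi> x) = x" if "x \<in> carrier L" for x
    using bij that by (auto simp: bij_betw_def inv_into_into f_inv_into_f)
  have uniq: "?\<phi> x = u" if "u \<in> carrier M" "\<psi> u = x" for u x
    using bij that by (auto simp: bij_betw_def)
  have "?\<phi> \<in> alg_iso L M"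
    unfolding alg_iso_def module_hom_def
  proof (intro CollectI conjI allI impI ballI)
    show "?\<phi> \<in> carrier L \<rightarrow> carrier M"
      using inv by auto
    show "bij_betw ?\<phi> (carrier L) (carrier M)"
      using bij by (rule bij_betw_inv_into)
    show "?\<phi> (x \<oplus>\<^bsub>L\<^esub> y) = ?\<phi> x \<oplus>\<^bsub>M\<^esub> ?\<phi> y" if "x \<in> carrier L \<and> y \<in> carrier L" for x y
      using that inv closed(1) module_hom_add[OF hom] by (intro uniq) auto
    show "?\<phi> (c \<odot>\<^bsub>L\<^esub> x) = c \<odot>\<^bsub>M\<^esub> ?\<phi> x" if "c \<in> carrier class_ring \<and> x \<in> carrier L" for c x
      using that inv closed(2) module_hom_smult[OF hom] by (intro uniq) auto
    show "?\<phi> (x \<otimes>\<^bsub>L\<^esub> y) = ?\<phi> x \<otimes>\<^bsub>M\<^esub> ?\<phi> y" if "x \<in> carrier L" "y \<in> carrier L" for x y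
      using that inv closed(3) mult by (intro uniq) auto
  qed
  then show ?thesis
    by (auto simp: alg_isomorphic_def)
qed

lemma table_algebra_simps [simp]:
  "carrier (table_algebra n T) = carrier_vec n"
  "u \<oplus>\<^bsub>table_algebra n T\<^esub> v = u + v"
  "c \<odot>\<^bsub>table_algebra n T\<^esub> v = c \<cdot>\<^sub>v v"
  "u \<otimes>\<^bsub>table_algebra n T\<^esub> v
    = vec n (\<lambda>k. \<Sum>i<n. \<Sum>j<n. u $ i * v $ j * T (Suc i) (Suc j) $ k)"
  by (simp_all add: table_algebra_def module_vec_def)

context leibniz_algebra
begin

text \<open>The coordinate map from vectors to \<open>L\<close>. Vectors are indexed from 0 and
  bases from 1, hence the shift by \<open>Suc\<close>.\<close>

definition vec_comb :: "(nat \<Rightarrow> 'a) \<Rightarrow> complex vec \<Rightarrow> 'a" where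
  "vec_comb e v = (\<Oplus>k\<in>{..<dim_vec v}. v $ k \<odot> e (Suc k))"

context
  fixes n :: nat and e :: "nat \<Rightarrow> 'a"
  assumes basis: "indexed_basis L e {1..n}"
begin

lemma e_Suc_carrier: "k < n \<Longrightarrow> e (Suc k) \<in> carrier L"
  using indexed_basis_carrier[OF basis, of "Suc k"] by simp

lemma basis_Suc: "indexed_basis L (\<lambda>k. e (Suc k)) {..<n}"
proof -
  have "(\<lambda>k. e (Suc k)) ` {..<n} = e ` {1..n}"
    unfolding image_image[of e Suc, symmetric] image_Suc_lessThan ..
  moreover have "inj_on (\<lambda>k. e (Suc k)) {..<n}"
    using comp_inj_on[of Suc "{..<n}" e] basis by (simp add: indexed_basis_def image_Suc_lessThan o_def)
  ultimately show ?thesis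
    using basis by (simp add: indexed_basis_def)
qed

lemma vec_comb_carrier: "v \<in> carrier_vec n \<Longrightarrow> vec_comb e v \<in> carrier L"
  using e_Suc_carrier by (auto simp: vec_comb_def intro!: finsum_closed)

lemma vec_comb_add:
  assumes "u \<in> carrier_vec n" "v \<in> carrier_vec n"
  shows "vec_comb e (u + v) = vec_comb e u \<oplus> vec_comb e v"
proof -
  have "vec_comb e (u + v) = (\<Oplus>k\<in>{..<n}. u $ k \<odot> e (Suc k) \<oplus> v $ k \<odot> e (Suc k))"
    using assms e_Suc_carrier unfolding vec_comb_def
    by (intro finsum_cong') (auto simp: smult_add_left)
  also have "\<dots> = vec_comb e u \<oplus> vec_comb e v"
    using assms e_Suc_carrier unfolding vec_comb_def by (subst finsum_addf) auto
  finally show ?thesis .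
qed

lemma vec_comb_smult:
  assumes "v \<in> carrier_vec n"
  shows "vec_comb e (c \<cdot>\<^sub>v v) = c \<odot> vec_comb e v"
proof -
  have "vec_comb e (c \<cdot>\<^sub>v v) = (\<Oplus>k\<in>{..<n}. c \<odot> (v $ k \<odot> e (Suc k)))"
    using assms e_Suc_carrier unfolding vec_comb_def
    by (intro finsum_cong') (auto simp: smult_mult)
  also have "\<dots> = c \<odot> vec_comb e v"
    using assms e_Suc_carrier unfolding vec_comb_def by (subst finsum_smult_right) auto
  finally show ?thesis .
qed

lemma vec_comb_zero: "vec_comb e (0\<^sub>v n) = \<zero>"
  using e_Suc_carrier by (auto simp: vec_comb_def intro!: add.finprod_one_eqI)

lemma vec_comb_std_basis:
  assumes "i \<in> {1..n}"
  shows "vec_comb e (std_basis n i) = e i"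
proof -
  have "vec_comb e (std_basis n i) = (\<Oplus>k\<in>{i - 1}. e (Suc k))"
    unfolding vec_comb_def std_basis_def
    using assms e_Suc_carrier indexed_basis_carrier[OF basis assms]
    by (intro add.finprod_mono_neutral_cong_right) (auto simp: unit_vec_def)
  then show ?thesis
    using assms indexed_basis_carrier[OF basis assms] by (simp add: finsum_insert)
qed

lemma vec_comb_bij: "bij_betw (vec_comb e) (carrier_vec n) (carrier L)"
  unfolding bij_betw_def
proof
  show "inj_on (vec_comb e) (carrier_vec n)"
  proof
    fix u v
    assume uv: "u \<in> carrier_vec n" "v \<in> carrier_vec n" "vec_comb e u = vec_comb e v"
    have "vec_comb e (u + (-1) \<cdot>\<^sub>v v) = \<zero>"
      using uv vec_comb_carrier by (simp add: vec_comb_add vec_comb_smult smult_uminus r_neg)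
    then have "(\<Oplus>k\<in>{..<n}. (u + (-1) \<cdot>\<^sub>v v) $ k \<odot> e (Suc k)) = \<zero>"
      using uv by (simp add: vec_comb_def)
    then have "(u + (-1) \<cdot>\<^sub>v v) $ k = 0" if "k < n" for k
      using indexed_basis_indep[OF basis_Suc] that by simp
    then show "u = v"
      using uv by (intro eq_vecI) auto
  qed
next
  have "x \<in> vec_comb e ` carrier_vec n" if x: "x \<in> carrier L" for x
  proof -
    obtain c where c: "x = (\<Oplus>k\<in>{..<n}. c k \<odot> e (Suc k))"
      using indexed_basis_repr[OF basis_Suc _ x] by auto
    have "vec_comb e (vec n c) = x"
      unfolding c vec_comb_def using e_Suc_carrier by (intro finsum_cong') auto
    then show ?thesis
      by force
  qed
  then show "vec_comb e ` carrier_vec n = carrier L"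
    using vec_comb_carrier by auto
qed

text \<open>Both products are bilinear and agree on the basis. The coordinate map goes from the
  table algebra to \<open>L\<close>, so the isomorphism is inverted at the end.\<close>

lemma isomorphic_table_algebra:
  assumes T: "\<And>i j. i \<in> {1..n} \<Longrightarrow> j \<in> {1..n} \<Longrightarrow> T i j \<in> carrier_vec n"
    and table: "\<And>i j. i \<in> {1..n} \<Longrightarrow> j \<in> {1..n} \<Longrightarrow> e i \<otimes> e j = vec_comb e (T i j)"
  shows "alg_isomorphic L (table_algebra n T)"
proof -
  have mult: "vec_comb e (u \<otimes>\<^bsub>table_algebra n T\<^esub> v) = vec_comb e u \<otimes> vec_comb e v"
    if u: "u \<in> carrier_vec n" and v: "v \<in> carrier_vec n" for u v
  proof -
    note [simp] = e_Suc_carrier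
    have "vec_comb e (u \<otimes>\<^bsub>table_algebra n T\<^esub> v)
        = (\<Oplus>k\<in>{..<n}. (\<Sum>i<n. \<Sum>j<n. u $ i * v $ j * T (Suc i) (Suc j) $ k) \<odot> e (Suc k))"
      unfolding vec_comb_def by (intro finsum_cong') auto
    also have "\<dots> = (\<Oplus>k\<in>{..<n}. \<Oplus>i\<in>{..<n}. \<Oplus>j\<in>{..<n}.
        (u $ i * v $ j * T (Suc i) (Suc j) $ k) \<odot> e (Suc k))"
    proof (intro finsum_cong')
      fix k
      assume "k \<in> {..<n}"
      then show "(\<Sum>i<n. \<Sum>j<n. u $ i * v $ j * T (Suc i) (Suc j) $ k) \<odot> e (Suc k) =
          (\<Oplus>i\<in>{..<n}. \<Oplus>j\<in>{..<n}. (u $ i * v $ j * T (Suc i) (Suc j) $ k) \<odot> e (Suc k))"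
        by (simp add: smult_sum_left)
    qed (auto intro!: finsum_closed)
    \<comment> \<open>Two interchanges bring the sum over \<open>k\<close> to the inside, where it
      assembles \<open>[e\<^sub>i, e\<^sub>j]\<close> from its coordinates.\<close>
    also have "\<dots> = (\<Oplus>i\<in>{..<n}. \<Oplus>k\<in>{..<n}. \<Oplus>j\<in>{..<n}.
        (u $ i * v $ j * T (Suc i) (Suc j) $ k) \<odot> e (Suc k))"
      by (intro finsum_finsum_commute) (auto intro!: finsum_closed)
    also have "\<dots> = (\<Oplus>i\<in>{..<n}. \<Oplus>j\<in>{..<n}. \<Oplus>k\<in>{..<n}.
        (u $ i * v $ j * T (Suc i) (Suc j) $ k) \<odot> e (Suc k))"
      by (intro finsum_cong' finsum_finsum_commute) (auto intro!: finsum_closed)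
    also have "\<dots> = (\<Oplus>i\<in>{..<n}. \<Oplus>j\<in>{..<n}. (u $ i \<odot> e (Suc i)) \<otimes> (v $ j \<odot> e (Suc j)))"
    proof (intro finsum_cong')
      fix i j
      assume ij: "i \<in> {..<n}" "j \<in> {..<n}"
      have "(\<Oplus>k\<in>{..<n}. (u $ i * v $ j * T (Suc i) (Suc j) $ k) \<odot> e (Suc k))
          = (\<Oplus>k\<in>{..<n}. (u $ i * v $ j) \<odot> (T (Suc i) (Suc j) $ k \<odot> e (Suc k)))"
        by (intro finsum_cong') (auto simp: smult_mult)
      also have "\<dots> = (u $ i * v $ j) \<odot> vec_comb e (T (Suc i) (Suc j))"
        using T[of "Suc i" "Suc j"] ij
        by (subst finsum_smult_right[symmetric]) (auto simp: vec_comb_def)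
      also have "\<dots> = (u $ i \<odot> e (Suc i)) \<otimes> (v $ j \<odot> e (Suc j))"
        using table[of "Suc i" "Suc j"] vec_comb_carrier[OF T[of "Suc i" "Suc j"]] ij
        by (simp add: bracket_smult_left bracket_smult_right smult_mult[symmetric] mult.commute)
      finally show "(\<Oplus>k\<in>{..<n}. (u $ i * v $ j * T (Suc i) (Suc j) $ k) \<odot> e (Suc k))
          = (u $ i \<odot> e (Suc i)) \<otimes> (v $ j \<odot> e (Suc j))" .
    qed (auto intro!: finsum_closed)
    also have "\<dots> = (\<Oplus>i\<in>{..<n}. (u $ i \<odot> e (Suc i)) \<otimes> vec_comb e v)"
      using v unfolding vec_comb_def
      by (intro finsum_cong') (auto simp: finsum_bracket_right intro!: finsum_closed bracket_closed)
    also have "\<dots> = vec_comb e u \<otimes> vec_comb e v"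
      using u vec_comb_carrier[OF v] unfolding vec_comb_def[of e u]
      by (subst finsum_bracket_left) auto
    finally show ?thesis .
  qed
  have "vec_comb e \<in> alg_iso (table_algebra n T) L"
    unfolding alg_iso_def module_hom_def
    using vec_comb_bij vec_comb_carrier vec_comb_add vec_comb_smult mult
    by (simp del: table_algebra_simps(4))
  then show ?thesis
    by (rule alg_isomorphic_sym) auto
qed

end

end

lemma std_basis_carrier [simp]: "std_basis n i \<in> carrier_vec n"
  by (simp add: std_basis_def)

section \<open>Normalisation of the structure constants\<close>

context mu_algebra
begin

lemma isomorphic_algebra:
  assumes "two_filiform L"
  shows "alg_isomorphic L (algebra1 n) \<or> alg_isomorphic L (algebra2 n)"
proof -
  from structure_constants obtain a b d where bd: "(b, d) \<noteq> (0, 0)"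
    and e1f: "e 1 \<otimes> f = a \<odot> e 2 \<oplus> b \<odot> g" and ff: "f \<otimes> f = d \<odot> g"
    and gf: "g \<otimes> f = \<zero>" and last: "e (n - 2) \<otimes> f = \<zero>"
    and ef: "\<forall>i\<in>{2..n - 3}. e i \<otimes> f = a \<odot> e (i + 1)"
    and zero: "\<forall>i\<in>{1..n}. \<forall>j\<in>{1..n} - {1, n - 1}. e i \<otimes> e j = \<zero>"
    by (elim exE conjE)
  have "d = 0"
    using square_coefficient_zero[OF assms e1f ff gf last bspec[OF ef]] .
  then have b: "b \<noteq> 0" and ff: "f \<otimes> f = \<zero>"
    using bd ff by auto
  \<comment> \<open>Scaling \<open>f\<close> by \<open>s\<close> turns \<open>a\<close> into
    \<epsilon>, which is 1 if \<open>a \<noteq> 0\<close> and 0 otherwise. Scaling \<open>g\<close>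
    by \<open>s * b\<close> then makes its coefficient in \<open>[e\<^sub>1, f]\<close> equal to
    1.\<close>
  define s where "s = (if a = 0 then 1 else 1 / a)"
  define \<epsilon> where "\<epsilon> = s * a"
  have s: "s \<noteq> 0"
    by (simp add: s_def)
  define e' where "e' = e(n - 1 := s \<odot> f, n := (s * b) \<odot> g)"
  have ne: "n - 1 \<noteq> n" "1 \<noteq> n" "1 \<noteq> n - 1" "2 \<noteq> n" "2 \<noteq> n - 1" "n - 2 \<noteq> n" "n - 2 \<noteq> n - 1"
    using n by linarith+
  have e': "e' i = e i" if "i \<noteq> n - 1" "i \<noteq> n" for i
    using that by (simp add: e'_def)
  have e'_f: "e' (n - 1) = s \<odot> f" and e'_g: "e' n = (s * b) \<odot> g"
    using ne(1) unfolding e'_def by (simp_all only: fun_upd_apply if_True if_False simp_thms)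
  \<comment> \<open>Every new vector is a nonzero multiple of the old one; both the basis property
    and the vanishing of products carry over from this.\<close>
  have scale: "\<exists>c. c \<noteq> 0 \<and> e' i = c \<odot> e i" if i: "i \<in> {1..n}" for i
  proof (cases "i = n - 1 \<or> i = n")
    case True
    then show ?thesis
      using e'_f e'_g s b by (metis mult_eq_0_iff)
  next
    case False
    then show ?thesis
      using e'[of i] smult_1[OF e_carrier[OF i]] by (intro exI[of _ 1]) simp
  qed
  have basis': "indexed_basis L e' {1..n}"
  proof (rule indexed_basisI[OF basis])
    show carr: "e' i \<in> carrier L" if "i \<in> {1..n}" for i
      using that by (simp add: e'_def)
    have sub: "e' ` {1..n} \<subseteq> carrier L"
      using carr by auto
    have mem: "e' i \<in> span (e' ` {1..n})" if "i \<in> {1..n}" for i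
      using in_own_span[OF sub] that by auto
    show "e i \<in> span (e' ` {1..n})" if i: "i \<in> {1..n}" for i
    proof -
      obtain c where "c \<noteq> 0" "e' i = c \<odot> e i"
        using scale[OF i] by blast
      then show ?thesis
        using span_smult_mem[OF sub, of "e i" c] mem[OF i] i by simp
    qed
  qed auto
  have sf [simp]: "s \<odot> f \<in> carrier L" "(s * b) \<odot> g \<in> carrier L"
    by simp_all
  have e'_1: "e' 1 = e 1" and e'_2: "e' 2 = e 2"
    using e'[of 1] e'[of 2] ne by blast+
  have right_1: "e' i \<otimes> e' 1 = e' (i + 1)" if "1 \<le> i" "i \<le> n - 3" for i
  proof -
    have "i \<noteq> n - 1" "i \<noteq> n" "i + 1 \<noteq> n - 1" "i + 1 \<noteq> n"
      using that n by linarith+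
    then have "e' i = e i" "e' (i + 1) = e (i + 1)"
      using e'[of i] e'[of "i + 1"] by blast+
    moreover have "e i \<otimes> e 1 = e (i + 1)"
      by (rule shift) (use that in simp)
    ultimately show ?thesis
      by (simp only: e'_1)
  qed
  have right_1_zero: "e' i \<otimes> e' 1 = \<zero>" if "i = n - 2 \<or> i = n - 1 \<or> i = n" for i
    using that
  proof (elim disjE)
    assume "i = n - 2"
    then show ?thesis
      using shift_zero[of "n - 2"] e'[OF ne(7,6)] by (simp only: e'_1) blast
  next
    assume "i = n - 1"
    then have "e' i \<otimes> e' 1 = (s \<odot> f) \<otimes> e 1"
      by (simp only: e'_f e'_1)
    then show ?thesis
      using f_e1 by (simp add: bracket_smult_left)
  next
    assume "i = n"
    then have "e' i \<otimes> e' 1 = ((s * b) \<odot> g) \<otimes> e 1"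
      by (simp only: e'_g e'_1)
    then show ?thesis
      using g_e1 by (simp add: bracket_smult_left)
  qed
  have right_f: "e' 1 \<otimes> e' (n - 1) = \<epsilon> \<odot> e' 2 \<oplus> e' n"
  proof -
    have "e 1 \<otimes> (s \<odot> f) = \<epsilon> \<odot> e 2 \<oplus> (s * b) \<odot> g"
      using e1f by (simp add: bracket_smult_right smult_add_right smult_mult \<epsilon>_def)
    then show ?thesis
      by (simp only: e'_1 e'_2 e'_f e'_g)
  qed
  have right_f': "e' i \<otimes> e' (n - 1) = \<epsilon> \<odot> e' (i + 1)" if "2 \<le> i" "i \<le> n - 3" for i
  proof -
    have ne': "i \<noteq> n - 1" "i \<noteq> n" "i + 1 \<noteq> n - 1" "i + 1 \<noteq> n" and le: "1 \<le> i" "i \<le> n" "1 \<le> i + 1" "i + 1 \<le> n"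
      using that n by linarith+
    have i: "i \<in> {2..n - 3}" "i \<in> {1..n}" "i + 1 \<in> {1..n}"
      unfolding atLeastAtMost_iff using that le by blast+
    then have "e i \<otimes> (s \<odot> f) = \<epsilon> \<odot> e (i + 1)"
      using bspec[OF ef i(1)] e_carrier[OF i(2)] e_carrier[OF i(3)]
      by (simp add: bracket_smult_right smult_mult \<epsilon>_def)
    then show ?thesis
      using e'[OF ne'(1,2)] e'[OF ne'(3,4)] by (simp only: e'_f)
  qed
  have right_f_zero: "e' i \<otimes> e' (n - 1) = \<zero>" if "i = n - 2 \<or> i = n - 1 \<or> i = n" for i
    using that
  proof (elim disjE)
    assume i: "i = n - 2"
    then have "e' i \<otimes> e' (n - 1) = e (n - 2) \<otimes> (s \<odot> f)"
      using e'[OF ne(7,6)] by (simp only: e'_f)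
    then show ?thesis
      using last e_carrier[of "n - 2"] n by (simp add: bracket_smult_right)
  next
    assume "i = n - 1"
    then have "e' i \<otimes> e' (n - 1) = (s \<odot> f) \<otimes> (s \<odot> f)"
      by (simp only: e'_f)
    then show ?thesis
      using ff by (simp add: bracket_smult_left bracket_smult_right)
  next
    assume "i = n"
    then have "e' i \<otimes> e' (n - 1) = ((s * b) \<odot> g) \<otimes> (s \<odot> f)"
      by (simp only: e'_f e'_g)
    then show ?thesis
      using gf by (simp add: bracket_smult_left bracket_smult_right)
  qed
  have right_zero: "e' i \<otimes> e' j = \<zero>" if ij: "i \<in> {1..n}" "j \<in> {1..n}" "j \<noteq> 1" "j \<noteq> n - 1" for i j
  proof -
    obtain c where "e' i = c \<odot> e i"
      using scale[OF ij(1)] by blast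
    moreover obtain c' where "e' j = c' \<odot> e j"
      using scale[OF ij(2)] by blast
    ultimately show ?thesis
      using bspec[OF bspec[OF zero ij(1)], of j] ij by (simp add: bracket_smult_left bracket_smult_right)
  qed
  have right_other: "e' i \<otimes> e' j = \<zero>" if i: "i \<in> {1..n}" and j: "j \<in> {1..n}"
    and other: "\<not> ((j = 1 \<or> j = n - 1) \<and> 1 \<le> i \<and> i \<le> n - 3)" for i j
  proof -
    have "1 \<le> i" "i \<le> n - 3 \<or> i = n - 2 \<or> i = n - 1 \<or> i = n"
      using i unfolding atLeastAtMost_iff by presburger+
    then show ?thesis
      using right_1_zero[of i] right_f_zero[of i] right_zero[OF i j] other by blast
  qed
  have idx: "n - 1 \<in> {1..n}" "1 \<in> {1..n}" "2 \<in> {1..n}" "n \<in> {1..n}" "1 \<le> n - 3"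
    unfolding atLeastAtMost_iff using n by linarith+
  have suc: "i + 1 \<in> {1..n}" if "i \<le> n - 3" for i
    unfolding atLeastAtMost_iff using that n by linarith
  note comb = vec_comb_std_basis[OF basis'] vec_comb_zero[OF basis']
    vec_comb_add[OF basis' std_basis_carrier std_basis_carrier]
  have e'_carrier: "e' i \<in> carrier L" if "i \<in> {1..n}" for i
    using indexed_basis_carrier[OF basis' that] .
  show ?thesis
  proof (cases "a = 0")
    case False
    then have \<epsilon>: "\<epsilon> = 1"
      by (simp add: \<epsilon>_def s_def)
    have "alg_isomorphic L (algebra1 n)"
      unfolding algebra1_def
    proof (rule isomorphic_table_algebra[OF basis'], goal_cases)
      case (2 i j)
      consider (1) "j = 1 \<and> 1 \<le> i \<and> i \<le> n - 3" | (2) "j = n - 1 \<and> i = 1"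
        | (3) "j = n - 1 \<and> 2 \<le> i \<and> i \<le> n - 3"
        | (4) "\<not> (j = 1 \<and> 1 \<le> i \<and> i \<le> n - 3)" "\<not> (j = n - 1 \<and> i = 1)"
          "\<not> (j = n - 1 \<and> 2 \<le> i \<and> i \<le> n - 3)"
        by blast
      then show ?case
      proof cases
        case c: 1
        then have j: "j = 1" and le: "1 \<le> i" "i \<le> n - 3"
          by blast+
        show ?thesis
          unfolding if_P[OF c] comb(1)[OF suc[OF le(2)]] unfolding j by (rule right_1[OF le])
      next
        case c: 2
        then have nc: "\<not> (j = 1 \<and> 1 \<le> i \<and> i \<le> n - 3)" and ij: "i = 1" "j = n - 1"
          using ne by blast+
        show ?thesis
          unfolding if_not_P[OF nc] if_P[OF c] comb(3) comb(1)[OF idx(3)] comb(1)[OF idx(4)]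
          using right_f smult_1[OF e'_carrier[OF idx(3)]] unfolding \<epsilon> ij by (simp only:)
      next
        case c: 3
        then have nc: "\<not> (j = 1 \<and> 1 \<le> i \<and> i \<le> n - 3)" "\<not> (j = n - 1 \<and> i = 1)"
          using ne by auto
        have j: "j = n - 1" and le: "2 \<le> i" "i \<le> n - 3"
          using c by blast+
        show ?thesis
          unfolding if_not_P[OF nc(1)] if_not_P[OF nc(2)] if_P[OF c] comb(1)[OF suc[OF le(2)]]
          using right_f'[OF le] smult_1[OF e'_carrier[OF suc[OF le(2)]]] unfolding \<epsilon> j by (simp only:)
      next
        case 4
        then have "\<not> ((j = 1 \<or> j = n - 1) \<and> 1 \<le> i \<and> i \<le> n - 3)"
          by linarith
        then show ?thesis
          unfolding if_not_P[OF 4(1)] if_not_P[OF 4(2)] if_not_P[OF 4(3)] comb(2) by (rule right_other[OF 2])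
      qed
    qed auto
    then show ?thesis ..
  next
    case True
    then have \<epsilon>: "\<epsilon> = 0"
      by (simp add: \<epsilon>_def s_def)
    have "alg_isomorphic L (algebra2 n)"
      unfolding algebra2_def
    proof (rule isomorphic_table_algebra[OF basis'], goal_cases)
      case (2 i j)
      consider (1) "j = 1 \<and> 1 \<le> i \<and> i \<le> n - 3" | (2) "j = n - 1 \<and> i = 1"
        | (3) "j = n - 1 \<and> 2 \<le> i \<and> i \<le> n - 3"
        | (4) "\<not> (j = 1 \<and> 1 \<le> i \<and> i \<le> n - 3)" "\<not> (j = n - 1 \<and> i = 1)"
          "\<not> (j = n - 1 \<and> 2 \<le> i \<and> i \<le> n - 3)"
        by blast
      then show ?case
      proof cases
        case c: 1
        then have j: "j = 1" and le: "1 \<le> i" "i \<le> n - 3"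
          by blast+
        show ?thesis
          unfolding if_P[OF c] comb(1)[OF suc[OF le(2)]] unfolding j by (rule right_1[OF le])
      next
        case c: 2
        then have nc: "\<not> (j = 1 \<and> 1 \<le> i \<and> i \<le> n - 3)" and ij: "i = 1" "j = n - 1"
          using ne by blast+
        show ?thesis
          unfolding if_not_P[OF nc] if_P[OF c] comb(1)[OF idx(4)]
          using right_f e'_carrier[OF idx(3)] e'_carrier[OF idx(4)]
          unfolding \<epsilon> ij by (simp only: smult_0 l_zero)
      next
        case c: 3
        then have nc: "\<not> (j = 1 \<and> 1 \<le> i \<and> i \<le> n - 3)" "\<not> (j = n - 1 \<and> i = 1)"
          using ne by auto
        have j: "j = n - 1" and le: "2 \<le> i" "i \<le> n - 3"
          using c by blast+
        show ?thesis
          unfolding if_not_P[OF nc(1)] if_not_P[OF nc(2)] comb(2)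
          using right_f'[OF le] smult_0[OF e'_carrier[OF suc[OF le(2)]]] unfolding \<epsilon> j by (simp only:)
      next
        case 4
        then have "\<not> ((j = 1 \<or> j = n - 1) \<and> 1 \<le> i \<and> i \<le> n - 3)"
          by linarith
        then show ?thesis
          unfolding if_not_P[OF 4(1)] if_not_P[OF 4(2)] comb(2) by (rule right_other[OF 2])
      qed
    qed auto
    then show ?thesis ..
  qed
qed

end

section \<open>The two algebras are not isomorphic\<close>

lemma table_algebra_unit_left:
  assumes "a < n" "v \<in> carrier_vec n" "k < n"
  shows "(unit_vec n a \<otimes>\<^bsub>table_algebra n T\<^esub> v) $ k = (\<Sum>j<n. v $ j * T (Suc a) (Suc j) $ k)"
proof -
  have "(unit_vec n a \<otimes>\<^bsub>table_algebra n T\<^esub> v) $ k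
      = (\<Sum>i<n. if i = a then \<Sum>j<n. v $ j * T (Suc a) (Suc j) $ k else 0)"
    using assms(1,3) by (simp del: sum.delta sum.delta') (rule sum.cong, auto)
  then show ?thesis
    using assms by simp
qed

lemma table_algebra_unit_right:
  assumes "b < n" "u \<in> carrier_vec n" "k < n"
  shows "(u \<otimes>\<^bsub>table_algebra n T\<^esub> unit_vec n b) $ k = (\<Sum>i<n. u $ i * T (Suc i) (Suc b) $ k)"
proof -
  have "(u \<otimes>\<^bsub>table_algebra n T\<^esub> unit_vec n b) $ k
      = (\<Sum>i<n. \<Sum>j<n. if j = b then u $ i * T (Suc i) (Suc b) $ k else 0)"
    using assms(1,3) by (simp del: sum.delta sum.delta') (intro sum.cong refl, auto)
  then show ?thesis
    using assms by simp
qed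

lemma table_algebra_diff_right:
  assumes "u \<in> carrier_vec n" "v \<in> carrier_vec n" "w \<in> carrier_vec n"
  shows "u \<otimes>\<^bsub>table_algebra n T\<^esub> (v - w)
    = u \<otimes>\<^bsub>table_algebra n T\<^esub> v - u \<otimes>\<^bsub>table_algebra n T\<^esub> w"
  using assms by (intro eq_vecI) (simp_all add: algebra_simps sum_subtractf)

lemma std_basis_index: "i < n \<Longrightarrow> std_basis n m $ i = (if i = m - 1 then 1 else 0)"
  by (simp add: std_basis_def unit_vec_def)

lemma dim_std_basis [simp]: "dim_vec (std_basis n m) = n"
  by (simp add: std_basis_def)

text \<open>Right multiplications by \<open>e\<^sub>1\<close> and
  \<open>e\<^sub>n\<^sub>-\<^sub>1\<close> agree on all basis vectors except
  \<open>e\<^sub>1\<close>, so right multiplication by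
  \<open>x = e\<^sub>1 - e\<^sub>n\<^sub>-\<^sub>1\<close> only sees the first coordinate. Brackets
  have none, whereas \<open>[x, x] = - e\<^sub>n\<close>.\<close>

lemma algebra1_square:
  assumes n: "n \<ge> 6"
  defines "x \<equiv> unit_vec n 0 - unit_vec n (n - 2)"
  shows "x \<in> carrier_vec n" "x \<otimes>\<^bsub>algebra1 n\<^esub> x \<noteq> 0\<^sub>v n"
    "\<And>y z. y \<in> carrier_vec n \<Longrightarrow> z \<in> carrier_vec n \<Longrightarrow> (y \<otimes>\<^bsub>algebra1 n\<^esub> z) \<otimes>\<^bsub>algebra1 n\<^esub> x = 0\<^sub>v n"
proof -
  define T where "T i j = (if j = 1 \<and> 1 \<le> i \<and> i \<le> n - 3 then std_basis n (i + 1)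
     else if j = n - 1 \<and> i = 1 then std_basis n 2 + std_basis n n
     else if j = n - 1 \<and> 2 \<le> i \<and> i \<le> n - 3 then std_basis n (i + 1)
     else 0\<^sub>v n)" for i j
  have A: "algebra1 n = table_algebra n T"
    unfolding algebra1_def T_def ..
  show x: "x \<in> carrier_vec n"
    by (simp add: x_def)
  have T_eq: "T i 1 = T i (n - 1)" if "i \<noteq> 1" for i
    using that n by (auto simp: T_def)
  have S: "Suc 0 = 1" "Suc (n - 2) = n - 1"
    using n by auto
  have dim: "dim_vec (u \<otimes>\<^bsub>table_algebra n T\<^esub> v) = n" for u v
    by simp
  have mult_x: "(w \<otimes>\<^bsub>algebra1 n\<^esub> x) $ k = w $ 0 * (T 1 1 $ k - T 1 (n - 1) $ k)"
    if "w \<in> carrier_vec n" "k < n" for w k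
  proof -
    have "(w \<otimes>\<^bsub>algebra1 n\<^esub> x) $ k
        = (\<Sum>i<n. w $ i * T (Suc i) 1 $ k) - (\<Sum>i<n. w $ i * T (Suc i) (n - 1) $ k)"
      using table_algebra_unit_right[of 0 n w k T] table_algebra_unit_right[of "n - 2" n w k T] that n
      unfolding A x_def S
      by (subst table_algebra_diff_right) (simp_all add: dim del: table_algebra_simps(4) One_nat_def)
    also have "\<dots> = (\<Sum>i<n. if i = 0 then w $ 0 * (T 1 1 $ k - T 1 (n - 1) $ k) else 0)"
      unfolding sum_subtractf[symmetric]
    proof (rule sum.cong)
      fix i
      show "w $ i * T (Suc i) 1 $ k - w $ i * T (Suc i) (n - 1) $ k
          = (if i = 0 then w $ 0 * (T 1 1 $ k - T 1 (n - 1) $ k) else 0)"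
        using T_eq[of "Suc i"] by (simp add: right_diff_distrib)
    qed simp
    finally show ?thesis
      using n by simp
  qed
  have "T 1 1 = std_basis n 2" "T 1 (n - 1) = std_basis n 2 + std_basis n n"
    using n by (auto simp: T_def numeral_2_eq_2)
  moreover have "x $ 0 = 1"
    using n by (simp add: x_def)
  ultimately have "(x \<otimes>\<^bsub>algebra1 n\<^esub> x) $ (n - 1) = -1"
    using mult_x[OF x, of "n - 1"] n by (simp add: std_basis_index)
  then show "x \<otimes>\<^bsub>algebra1 n\<^esub> x \<noteq> 0\<^sub>v n"
    using n by auto
  fix y z :: "complex vec"
  assume yz: "y \<in> carrier_vec n" "z \<in> carrier_vec n"
  have "T i j $ 0 = 0" for i j
    using n by (simp add: T_def std_basis_index)
  then have "(y \<otimes>\<^bsub>algebra1 n\<^esub> z) $ 0 = 0"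
    unfolding A using n by simp
  moreover have "y \<otimes>\<^bsub>algebra1 n\<^esub> z \<in> carrier_vec n"
    unfolding A by simp
  moreover have "dim_vec (v \<otimes>\<^bsub>algebra1 n\<^esub> x) = n" for v
    unfolding A by simp
  ultimately show "(y \<otimes>\<^bsub>algebra1 n\<^esub> z) \<otimes>\<^bsub>algebra1 n\<^esub> x = 0\<^sub>v n"
    using mult_x by (intro eq_vecI) simp_all
qed

text \<open>\<open>e\<^sub>2 = [e\<^sub>1, e\<^sub>1]\<close> is a bracket and
  \<open>[e\<^sub>2, x]\<close> is \<open>e\<^sub>3\<close> times the first coordinate of
  \<open>x\<close>, so this coordinate vanishes. Every nonzero table entry involves
  \<open>e\<^sub>1\<close> as a factor, so nothing remains of \<open>[x, x]\<close>.\<close>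

lemma algebra2_square:
  assumes n: "n \<ge> 6" and x: "x \<in> carrier_vec n"
    and annihilates: "\<And>y z. y \<in> carrier_vec n \<Longrightarrow> z \<in> carrier_vec n \<Longrightarrow>
      (y \<otimes>\<^bsub>algebra2 n\<^esub> z) \<otimes>\<^bsub>algebra2 n\<^esub> x = 0\<^sub>v n"
  shows "x \<otimes>\<^bsub>algebra2 n\<^esub> x = 0\<^sub>v n"
proof -
  define T where "T i j = (if j = 1 \<and> 1 \<le> i \<and> i \<le> n - 3 then std_basis n (i + 1)
     else if j = n - 1 \<and> i = 1 then std_basis n n
     else 0\<^sub>v n)" for i j
  have A: "algebra2 n = table_algebra n T"
    unfolding algebra2_def T_def ..
  let ?e = "unit_vec n :: nat \<Rightarrow> complex vec"
  have "?e 0 \<otimes>\<^bsub>algebra2 n\<^esub> ?e 0 = ?e 1"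
  proof (rule eq_vecI)
    fix k
    assume "k < dim_vec (?e 1)"
    then have k: "k < n"
      by simp
    then have "(?e 0 \<otimes>\<^bsub>algebra2 n\<^esub> ?e 0) $ k = (\<Sum>j<n. if j = 0 then T 1 1 $ k else 0)"
      unfolding A using n
      by (subst table_algebra_unit_left) (simp_all del: sum.delta sum.delta', intro sum.cong refl, auto)
    then show "(?e 0 \<otimes>\<^bsub>algebra2 n\<^esub> ?e 0) $ k = ?e 1 $ k"
      using n k by (simp add: T_def std_basis_index le_diff_conv2)
  qed (simp add: A)
  \<comment> \<open>Vectors are indexed from 0, so \<open>?e 1\<close> is \<open>e\<^sub>2\<close>
    and coordinate 2 belongs to \<open>e\<^sub>3\<close>.\<close>
  then have "(?e 1 \<otimes>\<^bsub>algebra2 n\<^esub> x) $ 2 = 0"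
    using annihilates[of "?e 0" "?e 0"] n by simp
  moreover have "(?e 1 \<otimes>\<^bsub>algebra2 n\<^esub> x) $ 2 = (\<Sum>j<n. if j = 0 then x $ 0 else 0)"
  proof -
    have "T 2 1 = std_basis n 3"
      using n by (auto simp: T_def)
    moreover have "T 2 j = 0\<^sub>v n" if "j \<noteq> 1" for j
      using n that by (auto simp: T_def)
    ultimately have "x $ j * T 2 (Suc j) $ 2 = (if j = 0 then x $ 0 else 0)" for j
      using n by (cases j) (auto simp: std_basis_index)
    then show ?thesis
      unfolding A using n x by (subst table_algebra_unit_left) (simp_all add: numeral_2_eq_2)
  qed
  ultimately have x0: "x $ 0 = 0"
    using n by simp
  have "x $ i * x $ j * T (Suc i) (Suc j) $ k = 0" if "k < n" for i j k
    using that x0 by (cases i; cases j) (auto simp: T_def)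
  then show ?thesis
    unfolding A by (intro eq_vecI) simp_all
qed

text \<open>Surjectivity of \<psi> carries the property of killing all brackets on the right from
  \<open>x\<close> to \<open>\<psi> x\<close>; injectivity then brings
  \<open>[\<psi> x, \<psi> x] = 0\<close> back to \<open>[x, x] = 0\<close>, which fails.\<close>

lemma algebra1_not_isomorphic_algebra2:
  assumes n: "n \<ge> 6"
  shows "\<not> alg_isomorphic (algebra1 n) (algebra2 n)"
proof
  assume "alg_isomorphic (algebra1 n) (algebra2 n)"
  then obtain \<psi> where \<psi>: "\<psi> \<in> alg_iso (algebra1 n) (algebra2 n)"
    by (auto simp: alg_isomorphic_def)
  have carr [simp]: "carrier (algebra1 n) = carrier_vec n" "carrier (algebra2 n) = carrier_vec n"
    by (simp_all add: algebra1_def algebra2_def)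
  have closed: "u \<otimes>\<^bsub>algebra1 n\<^esub> v \<in> carrier_vec n" for u v
    by (simp add: algebra1_def)
  have bij: "bij_betw \<psi> (carrier_vec n) (carrier_vec n)"
    and mult: "\<And>u v. u \<in> carrier_vec n \<Longrightarrow> v \<in> carrier_vec n \<Longrightarrow>
      \<psi> (u \<otimes>\<^bsub>algebra1 n\<^esub> v) = \<psi> u \<otimes>\<^bsub>algebra2 n\<^esub> \<psi> v"
    and hom: "\<psi> \<in> module_hom class_ring (algebra1 n) (algebra2 n)"
    using \<psi> by (auto simp: alg_iso_def)
  have "\<psi> (0 \<cdot>\<^sub>v 0\<^sub>v n) = 0 \<cdot>\<^sub>v \<psi> (0\<^sub>v n)"
    using module_hom_smult[OF hom, of 0 "0\<^sub>v n"] unfolding algebra1_def algebra2_def by simp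
  moreover have "\<psi> (0\<^sub>v n) \<in> carrier_vec n"
    using bij by (auto simp: bij_betw_def)
  moreover have "0 \<cdot>\<^sub>v u = 0\<^sub>v n" if "u \<in> carrier_vec n" for u :: "complex vec"
    using that by (intro eq_vecI) auto
  ultimately have \<psi>0: "\<psi> (0\<^sub>v n) = 0\<^sub>v n"
    by (metis zero_carrier_vec)
  define x :: "complex vec" where "x = unit_vec n 0 - unit_vec n (n - 2)"
  note x = algebra1_square[OF n, folded x_def]
  have "\<psi> x \<otimes>\<^bsub>algebra2 n\<^esub> \<psi> x = 0\<^sub>v n"
  proof (rule algebra2_square[OF n])
    show "\<psi> x \<in> carrier_vec n"
      using bij x(1) by (auto simp: bij_betw_def)
    fix y z :: "complex vec"
    assume "y \<in> carrier_vec n" "z \<in> carrier_vec n"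
    then obtain y' z' where yz: "y' \<in> carrier_vec n" "y = \<psi> y'" "z' \<in> carrier_vec n" "z = \<psi> z'"
      using bij unfolding bij_betw_def by blast
    have "(y \<otimes>\<^bsub>algebra2 n\<^esub> z) \<otimes>\<^bsub>algebra2 n\<^esub> \<psi> x = \<psi> ((y' \<otimes>\<^bsub>algebra1 n\<^esub> z') \<otimes>\<^bsub>algebra1 n\<^esub> x)"
      using yz x(1) closed by (simp add: mult)
    then show "(y \<otimes>\<^bsub>algebra2 n\<^esub> z) \<otimes>\<^bsub>algebra2 n\<^esub> \<psi> x = 0\<^sub>v n"
      using x(3)[OF yz(1,3)] \<psi>0 by simp
  qed
  then have "\<psi> (x \<otimes>\<^bsub>algebra1 n\<^esub> x) = \<psi> (0\<^sub>v n)"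
    using mult[OF x(1,1)] \<psi>0 by simp
  then show False
    using bij closed x(2) unfolding bij_betw_def by (auto dest!: inj_onD)
qed

theorem theorem2p5:
  fixes n :: nat
  assumes "n \<ge> 6"
  shows "(\<forall>L :: (complex, 'a) module.
            leibniz_algebra L \<and> alg_dim L = n \<and> naturally_graded L \<and> two_filiform L \<and>
            non_split L \<and> type_mu_I L 1 2 \<longrightarrow>
            alg_isomorphic L (algebra1 n) \<or> alg_isomorphic L (algebra2 n)) \<and>
         \<not> alg_isomorphic (algebra1 n) (algebra2 n)"
proof (intro conjI allI impI)
  show "\<not> alg_isomorphic (algebra1 n) (algebra2 n)"
    using algebra1_not_isomorphic_algebra2[OF assms] .
next
  fix L :: "(complex, 'a) module"
  assume L: "leibniz_algebra L \<and> alg_dim L = n \<and> naturally_graded L \<and> two_filiform L \<and>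
    non_split L \<and> type_mu_I L 1 2"
  then obtain \<phi> e where \<phi>: "\<phi> \<in> alg_iso L (gr L)" and e: "adapted_basis L \<phi> 1 2 e"
    by (auto simp: type_mu_I_def)
  interpret leibniz_algebra L
    using L by blast
  interpret leibniz_graded L \<phi>
    by unfold_locales (rule \<phi>)
  have dim: "dim = n"
    using L by blast
  have basis: "indexed_basis L e {1..n}"
    and shift: "\<forall>i\<in>{1..n - 3}. e i \<otimes>\<^bsub>L\<^esub> e 1 = e (i + 1)"
    and shift_zero: "\<forall>i\<in>{n - 2, n - 1, n}. e i \<otimes>\<^bsub>L\<^esub> e 1 = \<zero>\<^bsub>L\<^esub>"
    and deg: "\<forall>i\<in>{1..n - 2}. \<phi> (e i) \<in> gr_component L i"
      "\<phi> (e (n - 1)) \<in> gr_component L 1" "\<phi> (e n) \<in> gr_component L 2"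
    using e unfolding adapted_basis_def Let_def dim by blast+
  \<comment> \<open>The degrees of the adapted basis, given in the graded algebra, are pulled back
    to \<open>L\<close> along \<phi>; the last two are the 1 and 2 of the type.\<close>
  interpret mu_algebra L \<phi> n e
  proof
    show "n \<ge> 6" "indexed_basis L e {1..n}"
      by fact+
    show "e i \<otimes>\<^bsub>L\<^esub> e 1 = e (i + 1)" if "i \<in> {1..n - 3}" for i
      using shift that by blast
    show "e i \<otimes>\<^bsub>L\<^esub> e 1 = \<zero>\<^bsub>L\<^esub>" if "i \<in> {n - 2, n - 1, n}" for i
      using shift_zero that by blast
    show "e i \<in> homogeneous (if i = n - 1 then 1 else if i = n then 2 else i)" if i: "i \<in> {1..n}" for i
    proof -
      have "i = n - 1 \<or> i = n \<or> i \<in> {1..n - 2} \<and> i \<noteq> n - 1 \<and> i \<noteq> n"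
        using i assms unfolding atLeastAtMost_iff by presburger
      moreover have "n \<noteq> n - 1"
        using assms by linarith
      ultimately show ?thesis
        using deg mem_homogeneous_iff[OF indexed_basis_carrier[OF basis i]] by auto
    qed
  qed
  show "alg_isomorphic L (algebra1 n) \<or> alg_isomorphic L (algebra2 n)"
    using isomorphic_algebra L by blast
qed

end
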